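(* Let $\xi_1,\xi_2,\ldots$ be i.i.d.\ nonnegative real random variables whose right tail satisfies $\overline F(x):=\P(\xi_1\geq x)=x^{-1}\ell(x)$ for $x\to\infty$, where $\ell$ is a slowly varying function. Define $G(x):=\int_0^x\overline F(t)\,dt$ for $x\geq 0$, $S_n:=\sum_{i=1}^n\xi_i$ and $\overline F_n(x):=\P(S_n\geq x)$. Then: (a) For a positive sequence $(x_n)_{n\geq1}$, $$\lim_{n\to\infty}\sup_{x\geq x_n}\left|\frac{\overline F_n(x)}{n\overline F(x)}-1\right|=0$$ holds if and only if $\lim_{n\to\infty}\frac{x_n}{nG(x_n)}=\infty$. (b) Let $(x_n)_{n\geq1}$ and $(x_n')_{n\geq1}$ be positive sequences such that $x_n\leq x_n'$ for all $n$, $\liminf_{n\to\infty}\frac{x_n}{nG(x_n)}>0$ and $\limsup_{n\to\infty}\frac{x_n'}{nG(x_n')}<\infty$. Then for any positive sequence $(a_n)_{n\geq1}$ with $\lim_{n\to\infty}a_n\in(0,\infty)$, $$\lim_{n\to\infty}\sup_{x_n\leq x\leq x_n'}\left|\frac{\overline F_n\left(nG(x)+a_nx\right)}{n\overline F(a_nx)}-1\right|=0.$$ (c) If $(x_n)_{n\geq 1}$ is a positive sequence with $\limsup_{n\to\infty}\frac{x_n}{nG(x_n)}=0$, then $\lim_{n\to\infty}\overline F_n(x_n)=1$.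
   Context: A function $\ell$ is slowly varying if $\ell(\lambda x)/\ell(x)\to1$ as $x\to\infty$ for every $\lambda>0$. *)

theory Defs
  imports "HOL-Probability.Probability"
begin

definition slowly_varying :: "(real \<Rightarrow> real) \<Rightarrow> bool" where
  "slowly_varying l \<longleftrightarrow> (\<forall>c>0. ((\<lambda>x. l (c * x) / l x) \<longlongrightarrow> 1) at_top)"

text \<open>Tail of the common distribution: Fbar(x) = P(xi_1 >= x) (here xi is indexed from 0).\<close>
definition tailF :: "'a measure \<Rightarrow> (nat \<Rightarrow> 'a \<Rightarrow> real) \<Rightarrow> real \<Rightarrow> real" where
  "tailF M \<xi> x = measure M {\<omega> \<in> space M. \<xi> 0 \<omega> \<ge> x}"

definition tailFn :: "'a measure \<Rightarrow> (nat \<Rightarrow> 'a \<Rightarrow> real) \<Rightarrow> nat \<Rightarrow> real \<Rightarrow> real" where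
  "tailFn M \<xi> n x = measure M {\<omega> \<in> space M. (\<Sum>i<n. \<xi> i \<omega>) \<ge> x}"

definition Gint :: "'a measure \<Rightarrow> (nat \<Rightarrow> 'a \<Rightarrow> real) \<Rightarrow> real \<Rightarrow> real" where
  "Gint M \<xi> x = integral {0..x} (tailF M \<xi>)"

end

theory Submission
  imports Defs
begin

text \<open>Write \<open>F\<close> for the tail, \<open>G\<close> for its integral, so that \<open>G b\<close> is the mean of \<open>min \<xi> b\<close>, and \<open>V b\<close>
  for the second moment of \<open>min \<xi> b\<close>. Slow variation enters only through dyadic inductions giving
  \<open>V x = O(x\<^sup>2 F x)\<close> and \<open>x F x = o(G x)\<close>. Truncating at \<open>b = d y\<close>, Chebyshev's inequality shows
  that \<open>S\<^sub>n\<close> exceeds \<open>n G y + a y\<close> essentially only if a single summand exceeds about \<open>a y\<close>: the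
  contribution of all summands being below \<open>d y\<close> is \<open>O(d)\<close> times \<open>n F (a y)\<close>, and everything else
  is negligible as soon as \<open>y \<ge> c n G y\<close>. This gives one statement uniform in such \<open>y\<close>, from which
  (b) is immediate, (a) follows with \<open>a = 1 - n G y / y\<close>, and the converse in (a) by
  evaluating at a point where \<open>y = B n G y\<close>. Part (c) is Chebyshev alone.\<close>

subsection \<open>Truncated moments\<close>

text \<open>Induction on \<open>J\<close>: the new summand is independent of the sum over the rest,
  so the cross term has expectation equal to the product of the means and cancels. Square
  integrability is part of the conclusion because the next induction step needs it.\<close>

lemma (in prob_space) variance_sum_indep_vars:
  fixes X :: "'i \<Rightarrow> 'a \<Rightarrow> real"
  assumes "finite J" "indep_vars (\<lambda>_. borel) X J"
    and sq: "\<And>j. j \<in> J \<Longrightarrow> integrable M (\<lambda>\<omega>. (X j \<omega>)\<^sup>2)"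
  shows "integrable M (\<lambda>\<omega>. (\<Sum>j\<in>J. X j \<omega>)\<^sup>2) \<and>
    variance (\<lambda>\<omega>. \<Sum>j\<in>J. X j \<omega>) = (\<Sum>j\<in>J. variance (X j))"
  using assms
proof (induction J rule: finite_induct)
  case empty
  then show ?case by simp
next
  case (insert i J)
  let ?S = "\<lambda>\<omega>. \<Sum>j\<in>J. X j \<omega>"
  have rv: "random_variable borel (X j)" if "j \<in> insert i J" for j
    using insert.prems(1) that by (auto simp: indep_vars_def)
  have intX: "integrable M (X j)" if "j \<in> insert i J" for j
    using rv[OF that] insert.prems(2)[OF that] by (rule square_integrable_imp_integrable)
  have IH: "integrable M (\<lambda>\<omega>. (?S \<omega>)\<^sup>2)" "variance ?S = (\<Sum>j\<in>J. variance (X j))"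
    using insert.IH insert.prems indep_vars_subset[OF insert.prems(1), of J] by auto
  have intS: "integrable M ?S"
    using intX by auto
  have indep: "indep_var borel (X i) borel ?S"
    using insert by (intro indep_vars_sum) auto
  have prod: "expectation (\<lambda>\<omega>. X i \<omega> * ?S \<omega>) = expectation (X i) * expectation ?S"
    "integrable M (\<lambda>\<omega>. X i \<omega> * ?S \<omega>)"
    using indep_var_lebesgue_integral[OF indep] indep_var_integrable[OF indep] intX intS
    by auto
  have sqi: "integrable M (\<lambda>\<omega>. (X i \<omega>)\<^sup>2)" and Xi: "integrable M (X i)"
    using insert.prems(2) intX by auto
  have eq: "(\<lambda>\<omega>. (\<Sum>j\<in>insert i J. X j \<omega>)\<^sup>2) =
      (\<lambda>\<omega>. (X i \<omega>)\<^sup>2 + (?S \<omega>)\<^sup>2 + 2 * (X i \<omega> * ?S \<omega>))"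
    using insert.hyps by (auto simp: power2_eq_square algebra_simps)
  have int: "integrable M (\<lambda>\<omega>. (\<Sum>j\<in>insert i J. X j \<omega>)\<^sup>2)"
    unfolding eq using sqi IH(1) prod(2) by auto
  have intT: "integrable M (\<lambda>\<omega>. \<Sum>j\<in>insert i J. X j \<omega>)"
    using intX by auto
  have "variance (\<lambda>\<omega>. \<Sum>j\<in>insert i J. X j \<omega>) =
      expectation (\<lambda>\<omega>. (X i \<omega>)\<^sup>2 + (?S \<omega>)\<^sup>2 + 2 * (X i \<omega> * ?S \<omega>))
      - (expectation (\<lambda>\<omega>. X i \<omega> + ?S \<omega>))\<^sup>2"
    using variance_eq[OF intT int] eq insert.hyps by simp
  also have "\<dots> = variance (X i) + variance ?S"
    unfolding variance_eq[OF Xi sqi] variance_eq[OF intS IH(1)]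
    using sqi IH(1) prod Xi intS by (simp add: power2_eq_square algebra_simps)
  finally show ?case
    using int IH(2) insert.hyps by simp
qed

text \<open>Nonnegativity holds at every point here; the almost sure version is reduced to it in the
  final theorem.\<close>

locale nonneg_iid = prob_space M for M :: "'a measure" +
  fixes \<xi> :: "nat \<Rightarrow> 'a \<Rightarrow> real"
  assumes rv[measurable]: "\<And>i. \<xi> i \<in> borel_measurable M"
    and indep: "indep_vars (\<lambda>_. borel) \<xi> UNIV"
    and ident: "\<And>i. distr M borel (\<xi> i) = distr M borel (\<xi> 0)"
    and nonneg: "\<And>i \<omega>. 0 \<le> \<xi> i \<omega>"
begin

abbreviation F :: "real \<Rightarrow> real" where "F \<equiv> tailF M \<xi>"
abbreviation G :: "real \<Rightarrow> real" where "G \<equiv> Gint M \<xi>"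

definition V :: "real \<Rightarrow> real" where
  "V b = expectation (\<lambda>\<omega>. (min (\<xi> 0 \<omega>) b)\<^sup>2)"

lemma prob_ge: "prob {\<omega> \<in> space M. x \<le> \<xi> i \<omega>} = F x"
proof -
  have "prob {\<omega> \<in> space M. x \<le> \<xi> j \<omega>} = measure (distr M borel (\<xi> j)) {x..}" for j
    by (subst measure_distr) (auto intro!: arg_cong[where f = prob])
  then show ?thesis
    unfolding tailF_def using ident[of i] by simp
qed

lemma expectation_ident:
  fixes g :: "real \<Rightarrow> real"
  assumes [measurable]: "g \<in> borel_measurable borel"
  shows "expectation (\<lambda>\<omega>. g (\<xi> i \<omega>)) = expectation (\<lambda>\<omega>. g (\<xi> 0 \<omega>))"
proof -
  have "expectation (\<lambda>\<omega>. g (\<xi> j \<omega>)) = integral\<^sup>L (distr M borel (\<xi> j)) g" for j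
    by (subst integral_distr) auto
  then show ?thesis
    using ident[of i] by simp
qed

lemma F_antimono: "x \<le> y \<Longrightarrow> F y \<le> F x"
  unfolding tailF_def by (intro finite_measure_mono) auto

lemma F_nonneg: "0 \<le> F x" and F_le_1: "F x \<le> 1"
  by (auto simp: tailF_def)

lemma F_measurable[measurable]: "F \<in> borel_measurable borel"
proof -
  have "(\<lambda>x. - F x) \<in> borel_measurable borel"
    by (rule borel_measurable_mono) (auto intro!: monoI F_antimono)
  then show ?thesis by simp
qed

lemma integrable_min: "0 \<le> b \<Longrightarrow> integrable M (\<lambda>\<omega>. min (\<xi> i \<omega>) b)"
  using nonneg[of i] by (intro integrable_const_bound[where B = b]) (auto simp: abs_of_nonneg)

lemma integrable_min_sq: "0 \<le> b \<Longrightarrow> integrable M (\<lambda>\<omega>. (min (\<xi> i \<omega>) b)\<^sup>2)"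
  using nonneg[of i] by (intro integrable_const_bound[where B = "b\<^sup>2"]) (auto intro!: power_mono)

text \<open>Layer-cake formula: Tonelli applied to the indicator of the region
  \<open>0 \<le> t \<le> min (\<xi> 0 \<omega>) x\<close>, integrated in either order.\<close>

lemma G_eq:
  assumes "0 \<le> x"
  shows "G x = expectation (\<lambda>\<omega>. min (\<xi> 0 \<omega>) x)"
proof -
  interpret pair_sigma_finite M lborel ..
  have "(\<integral>\<^sup>+t\<in>{0..x}. F t \<partial>lborel)
      = (\<integral>\<^sup>+t. (\<integral>\<^sup>+\<omega>. indicator {p. 0 \<le> snd p \<and> snd p \<le> x \<and> snd p \<le> \<xi> 0 (fst p)} (\<omega>, t) \<partial>M) \<partial>lborel)"
  proof (intro nn_integral_cong)
    fix t :: real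
    have "(\<integral>\<^sup>+\<omega>. indicator {p. 0 \<le> snd p \<and> snd p \<le> x \<and> snd p \<le> \<xi> 0 (fst p)} (\<omega>, t) \<partial>M)
       = (\<integral>\<^sup>+\<omega>. indicator {0..x} t * indicator {\<omega> \<in> space M. t \<le> \<xi> 0 \<omega>} \<omega> \<partial>M)"
      by (intro nn_integral_cong) (auto split: split_indicator)
    also have "\<dots> = indicator {0..x} t * emeasure M {\<omega> \<in> space M. t \<le> \<xi> 0 \<omega>}"
      by (subst nn_integral_cmult) auto
    finally show "ennreal (F t) * indicator {0..x} t = (\<integral>\<^sup>+\<omega>. indicator {p. 0 \<le> snd p \<and> snd p \<le> x \<and> snd p \<le> \<xi> 0 (fst p)} (\<omega>, t) \<partial>M)"
      by (simp add: tailF_def emeasure_eq_measure mult.commute)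
  qed
  also have "\<dots> = (\<integral>\<^sup>+\<omega>. (\<integral>\<^sup>+t. indicator {p. 0 \<le> snd p \<and> snd p \<le> x \<and> snd p \<le> \<xi> 0 (fst p)} (\<omega>, t) \<partial>lborel) \<partial>M)"
    by (intro Fubini') measurable
  also have "\<dots> = (\<integral>\<^sup>+\<omega>. ennreal (min (\<xi> 0 \<omega>) x) \<partial>M)"
  proof (intro nn_integral_cong)
    fix \<omega>
    have "(\<integral>\<^sup>+t. indicator {p. 0 \<le> snd p \<and> snd p \<le> x \<and> snd p \<le> \<xi> 0 (fst p)} (\<omega>, t) \<partial>lborel)
      = (\<integral>\<^sup>+t. indicator {0..min (\<xi> 0 \<omega>) x} t \<partial>lborel)"
      by (intro nn_integral_cong) (auto split: split_indicator)
    then show "(\<integral>\<^sup>+t. indicator {p. 0 \<le> snd p \<and> snd p \<le> x \<and> snd p \<le> \<xi> 0 (fst p)} (\<omega>, t) \<partial>lborel)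
      = ennreal (min (\<xi> 0 \<omega>) x)"
      using nonneg[of 0 \<omega>] assms by simp
  qed
  also have "\<dots> = ennreal (expectation (\<lambda>\<omega>. min (\<xi> 0 \<omega>) x))"
    using integrable_min[OF assms] nonneg assms by (intro nn_integral_eq_integral) auto
  finally have eq: "(\<integral>\<^sup>+t\<in>{0..x}. F t \<partial>lborel) = ennreal (expectation (\<lambda>\<omega>. min (\<xi> 0 \<omega>) x))" .
  then have "ennreal (integral {0..x} F) = ennreal (expectation (\<lambda>\<omega>. min (\<xi> 0 \<omega>) x))"
    using F_nonneg
    by (subst set_nn_integral_lborel_eq_integral[symmetric]) (auto simp: set_borel_measurable_def)
  moreover have "0 \<le> integral {0..x} F"
    using F_nonneg by (cases "F integrable_on {0..x}")
      (auto intro!: Henstock_Kurzweil_Integration.integral_nonneg simp: not_integrable_integral)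
  ultimately show ?thesis
    using nonneg assms by (simp add: Gint_def)
qed

text \<open>The increment \<open>min \<xi> y - min \<xi> x\<close> vanishes for
  \<open>\<xi> < x\<close>, equals \<open>y - x\<close> for \<open>\<xi> \<ge> y\<close> and lies in
  between otherwise, so it is sandwiched between multiples of two indicators.\<close>

lemma G_diff:
  assumes "0 \<le> x" "x \<le> y"
  shows "(y - x) * F y \<le> G y - G x" "G y - G x \<le> (y - x) * F x"
proof -
  have int: "integrable M (\<lambda>\<omega>. (y - x) * indicator {\<omega> \<in> space M. z \<le> \<xi> 0 \<omega>} \<omega>)" for z
    by (auto intro!: integrable_mult_right simp: less_top[symmetric])
  have eq: "(y - x) * F z = expectation (\<lambda>\<omega>. (y - x) * indicator {\<omega> \<in> space M. z \<le> \<xi> 0 \<omega>} \<omega>)" for z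
    by (simp add: tailF_def)
  have G: "G y - G x = expectation (\<lambda>\<omega>. min (\<xi> 0 \<omega>) y - min (\<xi> 0 \<omega>) x)"
    using assms integrable_min by (simp add: G_eq)
  have intG: "integrable M (\<lambda>\<omega>. min (\<xi> 0 \<omega>) y - min (\<xi> 0 \<omega>) x)"
    using assms integrable_min by auto
  show "(y - x) * F y \<le> G y - G x" "G y - G x \<le> (y - x) * F x"
    unfolding eq G using assms
    by (intro integral_mono int intG; simp split: split_indicator)+
qed

lemma G_mono: "0 \<le> x \<Longrightarrow> x \<le> y \<Longrightarrow> G x \<le> G y"
  using G_diff(1)[of x y] mult_nonneg_nonneg[of "y - x" "F y"] F_nonneg[of y] by linarith

lemma G_0: "G 0 = 0"
  by (simp add: Gint_def)

lemma G_ge: "0 \<le> x \<Longrightarrow> x * F x \<le> G x" and G_le: "0 \<le> x \<Longrightarrow> G x \<le> x"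
  using G_diff[of 0 x] F_le_1[of 0] mult_left_mono[OF F_le_1[of 0], of x] by (auto simp: G_0)

lemma G_nonneg: "0 \<le> x \<Longrightarrow> 0 \<le> G x"
  using G_mono[of 0 x] by (simp add: G_0)

text \<open>\<open>G x / x\<close> is nonincreasing: beyond \<open>x\<close> the slope of
  \<open>G\<close> is at most \<open>F x\<close>, which is at most the average slope
  \<open>G x / x\<close>.\<close>

lemma G_concave:
  assumes "0 \<le> x" "x \<le> y"
  shows "x * G y \<le> y * G x"
proof -
  have "x * G y = x * G x + x * (G y - G x)" by algebra
  also have "\<dots> \<le> x * G x + x * ((y - x) * F x)"
    using G_diff[OF assms] assms by (intro add_left_mono mult_left_mono)
  also have "\<dots> = x * G x + (y - x) * (x * F x)" by algebra
  also have "\<dots> \<le> x * G x + (y - x) * G x"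
    using G_ge[OF assms(1)] assms by (intro add_left_mono mult_left_mono) auto
  finally show ?thesis by (simp add: algebra_simps)
qed

lemma V_nonneg: "0 \<le> V b"
  by (simp add: V_def)

lemma V_le:
  assumes "0 \<le> b"
  shows "V b \<le> b * G b"
proof -
  have "V b \<le> expectation (\<lambda>\<omega>. b * min (\<xi> 0 \<omega>) b)"
    unfolding V_def
    using assms nonneg integrable_min integrable_min_sq
    by (intro integral_mono) (auto simp: power2_eq_square intro!: mult_right_mono)
  then show ?thesis
    by (simp add: G_eq[OF assms])
qed

text \<open>Doubling the level changes the truncated variable only where
  \<open>\<xi> \<ge> z\<close>, and there its square is at most \<open>(2 * z)\<^sup>2\<close>. This
  is the recursion behind \<open>V_bound\<close>.\<close>

lemma V_double:
  assumes "0 \<le> z"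
  shows "V (2 * z) \<le> V z + (2 * z)\<^sup>2 * F z"
proof -
  have int: "integrable M (\<lambda>\<omega>. (2 * z)\<^sup>2 * indicator {\<omega> \<in> space M. z \<le> \<xi> 0 \<omega>} \<omega>)"
    by (auto intro!: integrable_mult_right simp: less_top[symmetric])
  have "V (2 * z) \<le> expectation (\<lambda>\<omega>. (min (\<xi> 0 \<omega>) z)\<^sup>2 +
      (2 * z)\<^sup>2 * indicator {\<omega> \<in> space M. z \<le> \<xi> 0 \<omega>} \<omega>)"
    unfolding V_def
  proof (intro integral_mono Bochner_Integration.integrable_add int integrable_min_sq)
    fix \<omega> assume "\<omega> \<in> space M"
    then show "(min (\<xi> 0 \<omega>) (2 * z))\<^sup>2 \<le> (min (\<xi> 0 \<omega>) z)\<^sup>2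
        + (2 * z)\<^sup>2 * indicator {\<omega> \<in> space M. z \<le> \<xi> 0 \<omega>} \<omega>"
      using nonneg[of 0 \<omega>] assms power_mono[of "min (\<xi> 0 \<omega>) (2 * z)" "2 * z" 2]
      by (cases "z \<le> \<xi> 0 \<omega>") (auto simp: min_def add_increasing)
  qed (use assms in auto)
  also have "\<dots> = V z + (2 * z)\<^sup>2 * F z"
    using integrable_min_sq[OF assms] int by (simp add: V_def tailF_def)
  finally show ?thesis .
qed

section \<open>Concentration of truncated sums, and independence of one summand from the
  others\<close>

lemma indep_min: "indep_vars (\<lambda>_. borel) (\<lambda>j \<omega>. min (\<xi> j \<omega>) b) J"
  by (rule indep_vars_compose2[OF indep_vars_subset[OF indep subset_UNIV]]) auto

text \<open>Chebyshev, with each variance bounded by the second moment \<open>V b\<close>. The index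
  set is arbitrary because the bound serves both the full sum and the sum with one index
  removed.\<close>

lemma truncated_sum_concentration:
  assumes "finite J" "0 \<le> b" "0 < t"
  shows "prob {\<omega> \<in> space M. t \<le> \<bar>(\<Sum>j\<in>J. min (\<xi> j \<omega>) b) - real (card J) * G b\<bar>}
    \<le> real (card J) * V b / t\<^sup>2"
proof -
  let ?T = "\<lambda>\<omega>. \<Sum>j\<in>J. min (\<xi> j \<omega>) b"
  have E: "expectation ?T = real (card J) * G b"
  proof -
    have "expectation ?T = (\<Sum>j\<in>J. expectation (\<lambda>\<omega>. min (\<xi> j \<omega>) b))"
      using integrable_min[OF assms(2)] by simp
    also have "\<dots> = (\<Sum>j\<in>J. G b)"
      unfolding G_eq[OF assms(2)] by (intro sum.cong expectation_ident refl) auto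
    finally show ?thesis
      by simp
  qed
  have "variance (\<lambda>\<omega>. min (\<xi> j \<omega>) b) \<le> V b" for j
    using variance_eq[OF integrable_min[OF assms(2), of j] integrable_min_sq[OF assms(2), of j]]
      expectation_ident[of "\<lambda>x. (min x b)\<^sup>2" j]
    by (simp add: V_def)
  then have "variance ?T \<le> real (card J) * V b"
    using variance_sum_indep_vars[OF assms(1) indep_min, of b] integrable_min_sq[OF assms(2)]
    by (simp add: sum_bounded_above)
  moreover have "prob {\<omega> \<in> space M. t \<le> \<bar>?T \<omega> - expectation ?T\<bar>} \<le> variance ?T / t\<^sup>2"
    using variance_sum_indep_vars[OF assms(1) indep_min, of b] integrable_min_sq[OF assms(2)] assms
    by (intro Chebyshev_inequality) auto
  ultimately show ?thesis
    using assms(3) unfolding E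
    by (meson divide_right_mono order_trans zero_le_power2)
qed

text \<open>Independence of the coordinate blocks \<open>{i}\<close> and \<open>J\<close>;
  \<open>P\<close> exhibits \<open>Q\<close> as an event depending on the block \<open>J\<close>
  alone.\<close>

lemma prob_indep_split:
  assumes "finite J" "i \<notin> J" and B: "Measurable.pred (Pi\<^sub>M J (\<lambda>_. borel)) P"
    and P: "\<And>\<omega>. P (restrict (\<lambda>j. \<xi> j \<omega>) J) \<longleftrightarrow> Q \<omega>"
  shows "prob {\<omega> \<in> space M. s \<le> \<xi> i \<omega> \<and> Q \<omega>} = F s * prob {\<omega> \<in> space M. Q \<omega>}"
proof -
  let ?A = "{f \<in> space (Pi\<^sub>M {i} (\<lambda>_. borel)). s \<le> f i}"
  let ?B = "{f \<in> space (Pi\<^sub>M J (\<lambda>_. borel)). P f}"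
  have ind: "indep_var (Pi\<^sub>M {i} (\<lambda>_. borel)) (\<lambda>\<omega>. restrict (\<lambda>j. \<xi> j \<omega>) {i})
      (Pi\<^sub>M J (\<lambda>_. borel)) (\<lambda>\<omega>. restrict (\<lambda>j. \<xi> j \<omega>) J)"
    using assms by (intro indep_var_restrict[OF indep]) auto
  have "?A \<in> sets (Pi\<^sub>M {i} (\<lambda>_. borel))" "?B \<in> sets (Pi\<^sub>M J (\<lambda>_. borel))"
    using B by (auto intro!: measurable_sets_borel)
  from indep_varD[OF ind this] show ?thesis
    unfolding prob_ge[of s i, symmetric]
    by (simp add: space_PiM P[symmetric] vimage_def Int_def conj_ac cong: conj_cong)
qed

end

subsection \<open>Single big jump bounds\<close>

context nonneg_iid
begin

text \<open>The good event for a big jump at \<open>i\<close>: the remaining summands are untouched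
  by truncation at \<open>b\<close>, and their sum is within \<open>t\<close> of its truncated mean.
  The count \<open>n - 1\<close> is the right one for \<open>i < n\<close>.\<close>

definition others_typical :: "nat \<Rightarrow> nat \<Rightarrow> real \<Rightarrow> real \<Rightarrow> 'a \<Rightarrow> bool" where
  "others_typical n i b t \<omega> \<longleftrightarrow> (\<forall>j\<in>{..<n} - {i}. \<xi> j \<omega> < b) \<and>
     \<bar>(\<Sum>j\<in>{..<n} - {i}. \<xi> j \<omega>) - real (n - 1) * G b\<bar> < t"

lemma others_typical_measurable[measurable]:
  "Measurable.pred M (others_typical n i b t)"
  unfolding others_typical_def by measurable

lemma prob_ge_and_typical:
  "prob {\<omega> \<in> space M. s \<le> \<xi> i \<omega> \<and> others_typical n i b t \<omega>} =
     F s * prob {\<omega> \<in> space M. others_typical n i b t \<omega>}"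
  "prob {\<omega> \<in> space M. s \<le> \<xi> i \<omega> \<and> \<not> others_typical n i b t \<omega>} =
     F s * prob {\<omega> \<in> space M. \<not> others_typical n i b t \<omega>}"
proof -
  let ?J = "{..<n} - {i}"
  let ?P = "\<lambda>f. (\<forall>j\<in>?J. f j < b) \<and> \<bar>(\<Sum>j\<in>?J. f j) - real (n - 1) * G b\<bar> < t"
  have [measurable]: "Measurable.pred (Pi\<^sub>M ?J (\<lambda>_. borel)) ?P"
    by measurable
  have P: "?P (restrict (\<lambda>j. \<xi> j \<omega>) ?J) \<longleftrightarrow> others_typical n i b t \<omega>" for \<omega>
    by (simp add: others_typical_def)
  show "prob {\<omega> \<in> space M. s \<le> \<xi> i \<omega> \<and> others_typical n i b t \<omega>} =
     F s * prob {\<omega> \<in> space M. others_typical n i b t \<omega>}"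
    by (rule prob_indep_split[where P = ?P and J = ?J]) (use P in auto)
  show "prob {\<omega> \<in> space M. s \<le> \<xi> i \<omega> \<and> \<not> others_typical n i b t \<omega>} =
     F s * prob {\<omega> \<in> space M. \<not> others_typical n i b t \<omega>}"
    by (rule prob_indep_split[where P = "\<lambda>f. \<not> ?P f" and J = ?J]) (use P in auto)
qed

text \<open>If no other summand reaches \<open>b\<close>, their sum equals its truncated version, so
  failure means a Chebyshev deviation; otherwise a union bound applies.\<close>

lemma prob_not_typical_le:
  assumes "i < n" "0 \<le> b" "0 < t"
  shows "prob {\<omega> \<in> space M. \<not> others_typical n i b t \<omega>} \<le> real n * F b + real n * V b / t\<^sup>2"
proof -
  let ?J = "{..<n} - {i}"
  have card: "card ?J = n - 1"
    using assms(1) by simp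
  let ?A = "\<Union>j\<in>?J. {\<omega> \<in> space M. b \<le> \<xi> j \<omega>}"
  let ?B = "{\<omega> \<in> space M. t \<le> \<bar>(\<Sum>j\<in>?J. min (\<xi> j \<omega>) b) - real (card ?J) * G b\<bar>}"
  have "prob {\<omega> \<in> space M. \<not> others_typical n i b t \<omega>} \<le> prob (?A \<union> ?B)"
  proof (rule finite_measure_mono)
    show "{\<omega> \<in> space M. \<not> others_typical n i b t \<omega>} \<subseteq> ?A \<union> ?B"
    proof (rule subsetI, rule ccontr)
      fix \<omega> assume \<omega>: "\<omega> \<in> {\<omega> \<in> space M. \<not> others_typical n i b t \<omega>}" "\<omega> \<notin> ?A \<union> ?B"
      then have small: "\<forall>j\<in>?J. \<xi> j \<omega> < b"
        by force
      then have "(\<Sum>j\<in>?J. min (\<xi> j \<omega>) b) = (\<Sum>j\<in>?J. \<xi> j \<omega>)"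
        by (intro sum.cong) auto
      with \<omega> small show False
        unfolding others_typical_def card by auto
    qed
  qed measurable
  also have "\<dots> \<le> prob ?A + prob ?B"
    by (intro measure_Un_le) measurable
  also have "prob ?A \<le> (\<Sum>j\<in>?J. prob {\<omega> \<in> space M. b \<le> \<xi> j \<omega>})"
    by (intro finite_measure_subadditive_finite) auto
  also have "\<dots> = real (card ?J) * F b"
    by (simp add: prob_ge)
  also have "prob ?B \<le> real (card ?J) * V b / t\<^sup>2"
    using assms by (intro truncated_sum_concentration) auto
  also have "real (card ?J) * F b + real (card ?J) * V b / t\<^sup>2 \<le> real n * F b + real n * V b / t\<^sup>2"
    unfolding card using F_nonneg V_nonneg
    by (intro add_mono mult_right_mono divide_right_mono) auto
  finally show ?thesis by simp
qed

lemma sum_split_off: "i < n \<Longrightarrow> (\<Sum>j<n. \<xi> j \<omega>) = \<xi> i \<omega> + (\<Sum>j\<in>{..<n} - {i}. \<xi> j \<omega>)"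
  by (intro sum.remove) auto

text \<open>Three ways to reach \<open>z\<close>. \<open>?A\<close>: one summand is large enough
  given typical others. \<open>?B\<close>: a summand reaches \<open>b\<close> while the others are
  atypical, which by independence costs a product of two small factors. \<open>?C\<close>: no
  summand reaches \<open>b\<close>, so the truncated sum exceeds its mean by at least
  \<open>s\<close>.\<close>

lemma tailFn_upper:
  assumes "0 \<le> b" "0 < t" "0 < s" "real n * G b + s \<le> z"
  shows "tailFn M \<xi> n z \<le> real n * F (z - real (n - 1) * G b - t)
    + real n * F b * (real n * F b + real n * V b / t\<^sup>2) + real n * V b / s\<^sup>2"
proof -
  let ?z = "z - real (n - 1) * G b - t"
  let ?A = "\<Union>i\<in>{..<n}. {\<omega> \<in> space M. ?z \<le> \<xi> i \<omega>}"
  let ?B = "\<Union>i\<in>{..<n}. {\<omega> \<in> space M. b \<le> \<xi> i \<omega> \<and> \<not> others_typical n i b t \<omega>}"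
  let ?C = "{\<omega> \<in> space M. s \<le> \<bar>(\<Sum>j<n. min (\<xi> j \<omega>) b) - real (card {..<n}) * G b\<bar>}"
  have "tailFn M \<xi> n z \<le> prob ((?A \<union> ?B) \<union> ?C)"
    unfolding tailFn_def
  proof (rule finite_measure_mono)
    show "{\<omega> \<in> space M. z \<le> (\<Sum>i<n. \<xi> i \<omega>)} \<subseteq> (?A \<union> ?B) \<union> ?C"
    proof (rule subsetI, rule ccontr)
      fix \<omega> assume \<omega>: "\<omega> \<in> {\<omega> \<in> space M. z \<le> (\<Sum>i<n. \<xi> i \<omega>)}" "\<omega> \<notin> (?A \<union> ?B) \<union> ?C"
      then have small: "\<forall>i<n. \<xi> i \<omega> < ?z"
        and typical: "\<forall>i<n. b \<le> \<xi> i \<omega> \<longrightarrow> others_typical n i b t \<omega>"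
        by force+
      show False
      proof (cases "\<exists>i<n. b \<le> \<xi> i \<omega>")
        case True
        then obtain i where i: "i < n" "b \<le> \<xi> i \<omega>" by auto
        then have "others_typical n i b t \<omega>"
          using typical by auto
        with small i sum_split_off[OF i(1), of \<omega>] \<omega>(1) show False
          unfolding others_typical_def by force
      next
        case False
        then have "(\<Sum>j<n. min (\<xi> j \<omega>) b) = (\<Sum>j<n. \<xi> j \<omega>)"
          by (intro sum.cong) auto
        with \<omega> assms(4) show False by auto
      qed
    qed
  qed measurable
  also have "\<dots> \<le> prob (?A \<union> ?B) + prob ?C"
    by (intro measure_Un_le) measurable
  also have "prob (?A \<union> ?B) \<le> prob ?A + prob ?B"
    by (intro measure_Un_le) measurable
  also have "prob ?A \<le> (\<Sum>i<n. prob {\<omega> \<in> space M. ?z \<le> \<xi> i \<omega>})"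
    by (intro finite_measure_subadditive_finite) auto
  also have "\<dots> = real n * F ?z"
    by (simp only: prob_ge sum_constant card_lessThan)
  also have "prob ?B \<le> (\<Sum>i<n. prob {\<omega> \<in> space M. b \<le> \<xi> i \<omega> \<and> \<not> others_typical n i b t \<omega>})"
    by (intro finite_measure_subadditive_finite) auto
  also have "\<dots> \<le> (\<Sum>i<n. F b * (real n * F b + real n * V b / t\<^sup>2))"
    unfolding prob_ge_and_typical using assms
    by (intro sum_mono mult_left_mono prob_not_typical_le F_nonneg) auto
  also have "prob ?C \<le> real n * V b / s\<^sup>2"
    using truncated_sum_concentration[of "{..<n}" b s] assms by simp
  finally show ?thesis by (simp add: mult.assoc)
qed

text \<open>Exceeding \<open>b\<close> while all other summands stay below \<open>b\<close> makes the events for different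
  indices disjoint, so no Bonferroni correction is needed.\<close>

lemma tailFn_lower:
  assumes "0 \<le> b" "0 < t" "b \<le> z - real (n - 1) * G b + t"
  shows "real n * F (z - real (n - 1) * G b + t) * (1 - (real n * F b + real n * V b / t\<^sup>2))
    \<le> tailFn M \<xi> n z"
proof -
  let ?z = "z - real (n - 1) * G b + t"
  let ?E = "\<lambda>i. {\<omega> \<in> space M. ?z \<le> \<xi> i \<omega> \<and> others_typical n i b t \<omega>}"
  have "1 - (real n * F b + real n * V b / t\<^sup>2) \<le> prob {\<omega> \<in> space M. others_typical n i b t \<omega>}"
    if "i < n" for i
    using prob_not_typical_le[OF that assms(1,2)] prob_neg[of "others_typical n i b t"] by simp
  then have "(\<Sum>i<n. F ?z * (1 - (real n * F b + real n * V b / t\<^sup>2))) \<le> (\<Sum>i<n. prob (?E i))"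
    unfolding prob_ge_and_typical by (intro sum_mono mult_left_mono F_nonneg) auto
  also have "\<dots> = prob (\<Union>i\<in>{..<n}. ?E i)"
  proof (intro finite_measure_finite_Union[symmetric])
    show "disjoint_family_on ?E {..<n}"
      unfolding disjoint_family_on_def
    proof (intro ballI impI, rule ccontr)
      fix i j assume ij: "i \<in> {..<n}" "j \<in> {..<n}" "i \<noteq> j" "?E i \<inter> ?E j \<noteq> {}"
      then obtain \<omega> where "?z \<le> \<xi> i \<omega>" "others_typical n j b t \<omega>" by auto
      with ij assms(3) show False
        unfolding others_typical_def by force
    qed
  qed auto
  also have "\<dots> \<le> tailFn M \<xi> n z"
    unfolding tailFn_def
  proof (rule finite_measure_mono)
    show "(\<Union>i\<in>{..<n}. ?E i) \<subseteq> {\<omega> \<in> space M. z \<le> (\<Sum>i<n. \<xi> i \<omega>)}"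
    proof
      fix \<omega> assume "\<omega> \<in> (\<Union>i\<in>{..<n}. ?E i)"
      then obtain i where "i < n" "\<omega> \<in> space M" "?z \<le> \<xi> i \<omega>" "others_typical n i b t \<omega>"
        by blast
      then show "\<omega> \<in> {\<omega> \<in> space M. z \<le> (\<Sum>i<n. \<xi> i \<omega>)}"
        using sum_split_off[of i n \<omega>] unfolding others_typical_def by auto
    qed
  qed measurable
  finally show ?thesis by (simp only: mult.assoc sum_constant card_lessThan)
qed

text \<open>Truncating at \<open>y\<close> itself only lowers the sum, and the truncated mean
  \<open>n G y\<close> still exceeds \<open>y\<close>; staying below \<open>y\<close> is then a
  deviation, bounded with \<open>V y \<le> y * G y\<close>.\<close>

lemma tailFn_near_1:
  assumes "0 < n" "0 < y" "y < real n * G y"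
  shows "1 - real n * y * G y / (real n * G y - y)\<^sup>2 \<le> tailFn M \<xi> n y"
proof -
  let ?t = "real n * G y - y"
  let ?B = "{\<omega> \<in> space M. ?t \<le> \<bar>(\<Sum>j<n. min (\<xi> j \<omega>) y) - real (card {..<n}) * G y\<bar>}"
  have "prob {\<omega> \<in> space M. \<not> y \<le> (\<Sum>i<n. \<xi> i \<omega>)} \<le> prob ?B"
  proof (rule finite_measure_mono)
    show "{\<omega> \<in> space M. \<not> y \<le> (\<Sum>i<n. \<xi> i \<omega>)} \<subseteq> ?B"
    proof clarify
      fix \<omega> assume \<omega>: "\<not> y \<le> (\<Sum>i<n. \<xi> i \<omega>)"
      have "(\<Sum>j<n. min (\<xi> j \<omega>) y) \<le> (\<Sum>i<n. \<xi> i \<omega>)"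
        by (intro sum_mono) auto
      with \<omega> show "?t \<le> \<bar>(\<Sum>j<n. min (\<xi> j \<omega>) y) - real (card {..<n}) * G y\<bar>"
        by simp
    qed
  qed measurable
  also have "\<dots> \<le> real n * V y / ?t\<^sup>2"
    using truncated_sum_concentration[of "{..<n}" y ?t] assms by simp
  also have "\<dots> \<le> real n * (y * G y) / ?t\<^sup>2"
    using V_le[of y] assms by (intro divide_right_mono mult_left_mono) auto
  finally show ?thesis
    unfolding tailFn_def using prob_neg[of "\<lambda>\<omega>. y \<le> (\<Sum>i<n. \<xi> i \<omega>)"] by (simp add: mult.assoc)
qed

end

subsection \<open>Consequences of slow variation\<close>

locale slowly_varying_iid = nonneg_iid +
  assumes tail: "slowly_varying (\<lambda>x. x * tailF M \<xi> x)"
begin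

text \<open>Slow variation with factor 1 says that \<open>y F y / (y F y)\<close> tends to 1; since
  \<open>0 / 0 = 0\<close>, this forces \<open>F\<close> to be nonzero at arbitrarily large points,
  and monotonicity does the rest.\<close>

lemma F_pos: "0 < F x"
proof -
  have "((\<lambda>y. (1 * y * F (1 * y)) / (y * F y)) \<longlongrightarrow> 1) at_top"
    using tail unfolding slowly_varying_def by (elim allE[of _ 1]) simp
  then have "\<forall>\<^sub>F y in at_top. 0 < (y * F y) / (y * F y)"
    by (intro order_tendstoD(1)[of _ 1]) auto
  then obtain N where "\<And>y. N \<le> y \<Longrightarrow> 0 < (y * F y) / (y * F y)"
    by (auto simp only: eventually_at_top_linorder)
  then obtain y where "x \<le> y" "0 < (y * F y) / (y * F y)"
    using max.cobounded1 max.cobounded2 by blast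
  then have "F y \<noteq> 0" "F y \<le> F x"
    by (auto simp: F_antimono)
  then show ?thesis
    using F_nonneg[of y] by linarith
qed

lemma F_ratio:
  assumes "0 < c"
  shows "((\<lambda>x. F (c * x) / F x) \<longlongrightarrow> 1 / c) at_top"
proof -
  have "((\<lambda>x. (1 / c) * (c * x * F (c * x) / (x * F x))) \<longlongrightarrow> (1 / c) * 1) at_top"
    using tail assms unfolding slowly_varying_def by (intro tendsto_mult) auto
  moreover have "\<forall>\<^sub>F x in at_top. (1 / c) * (c * x * F (c * x) / (x * F x)) = F (c * x) / F x"
    using eventually_gt_at_top[of 0] by eventually_elim (use assms in auto)
  ultimately show ?thesis
    unfolding mult_1_right by (rule Lim_transform_eventually)
qed

lemma F_ratio2:
  assumes "0 < c" "0 < d"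
  shows "((\<lambda>x. F (c * x) / F (d * x)) \<longlongrightarrow> d / c) at_top"
proof -
  have "((\<lambda>x. (F (c * x) / F x) / (F (d * x) / F x)) \<longlongrightarrow> (1 / c) / (1 / d)) at_top"
    using assms by (intro tendsto_divide F_ratio) auto
  moreover have "F x \<noteq> 0" for x
    using F_pos[of x] by simp
  ultimately show ?thesis
    by simp
qed

text \<open>Dyadic induction: passing from \<open>z\<close> to \<open>2 * z\<close> multiplies
  \<open>x\<^sup>2\<close> by 4, while \<open>F\<close> drops by a factor close to 2 only, so the
  right-hand side grows enough to absorb the term added by \<open>V_double\<close>.\<close>

lemma V_bound: "\<exists>K\<ge>0. \<forall>\<^sub>F x in at_top. V x \<le> K * x\<^sup>2 * F x"
proof -
  \<comment> \<open>The ratio tends to 1/2; the induction needs a lower bound strictly above 1/4,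
    and 1/3 lies between.\<close>
  have "\<forall>\<^sub>F x in at_top. 1 / 3 < F (2 * x) / F x"
    using F_ratio[of 2] by (intro order_tendstoD(1)[of _ "1/2"]) auto
  then obtain z0 where z0: "\<And>z. z0 \<le> z \<Longrightarrow> 1 / 3 < F (2 * z) / F z"
    by (auto simp: eventually_at_top_linorder)
  define w where "w = max z0 1"
  have half: "F z \<le> 3 * F (2 * z)" if "w \<le> z" for z
    using z0[of z] that F_pos[of z] by (simp add: w_def field_simps)
  \<comment> \<open>The value 12 gives \<open>3 * K + 12 \<le> 4 * K\<close>, which closes the
    induction step; \<open>1 / F (2 * w)\<close> covers the base interval from \<open>w\<close> to
    \<open>2 * w\<close>, where \<open>V x \<le> x\<^sup>2\<close>.\<close>
  define K where "K = max 12 (1 / F (2 * w))"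
  have K: "12 \<le> K" "1 \<le> K * F (2 * w)"
    using F_pos[of "2 * w"] by (auto simp: K_def max_def field_simps)
  have base: "V x \<le> K * x\<^sup>2 * F x" if "w \<le> x" "x \<le> 2 * w" for x
  proof -
    have "V x \<le> x * G x" "G x \<le> x" "0 \<le> x"
      using that by (auto intro!: V_le G_le simp: w_def)
    then have "V x \<le> x\<^sup>2 * 1"
      using mult_left_mono[of "G x" x x] by (simp add: power2_eq_square)
    also have "\<dots> \<le> x\<^sup>2 * (K * F (2 * w))"
      using K by (intro mult_left_mono) auto
    also have "\<dots> \<le> x\<^sup>2 * (K * F x)"
      using K that F_antimono by (intro mult_left_mono) auto
    finally show ?thesis by (simp add: algebra_simps)
  qed
  have "V x \<le> K * x\<^sup>2 * F x" if "w \<le> x" "x \<le> 2 ^ n * (2 * w)" for n x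
    using that
  proof (induction n arbitrary: x)
    case 0
    then show ?case using base by simp
  next
    case (Suc n)
    show ?case
    proof (cases "x \<le> 2 * w")
      case True
      then show ?thesis using base Suc.prems by simp
    next
      case False
      define z where "z = x / 2"
      have x: "x = 2 * z" and z: "w \<le> z" "z \<le> 2 ^ n * (2 * w)" "0 \<le> z"
        using False Suc.prems by (auto simp: z_def w_def)
      have "V x \<le> V z + (2 * z)\<^sup>2 * F z"
        unfolding x using z by (intro V_double)
      also have "\<dots> \<le> K * z\<^sup>2 * F z + (2 * z)\<^sup>2 * F z"
        using Suc.IH z by simp
      also have "\<dots> = (K + 4) * z\<^sup>2 * F z"
        by (simp add: power2_eq_square algebra_simps)
      also have "\<dots> \<le> (K + 4) * z\<^sup>2 * (3 * F (2 * z))"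
        using half[OF z(1)] K by (intro mult_left_mono) auto
      also have "\<dots> = (3 * K + 12) * (z\<^sup>2 * F (2 * z))"
        by (simp add: algebra_simps)
      also have "\<dots> \<le> (4 * K) * (z\<^sup>2 * F (2 * z))"
        using K F_nonneg by (intro mult_right_mono) auto
      finally show ?thesis
        by (simp add: x power2_eq_square algebra_simps)
    qed
  qed
  moreover have "\<exists>n. x \<le> 2 ^ n * (2 * w)" for x
  proof -
    obtain n where "x / (2 * w) < 2 ^ n"
      using real_arch_pow[of 2 "x / (2 * w)"] by auto
    then show ?thesis
      by (intro exI[of _ n]) (simp add: w_def field_simps)
  qed
  ultimately have "\<forall>\<^sub>F x in at_top. V x \<le> K * x\<^sup>2 * F x"
    unfolding eventually_at_top_linorder by blast
  then show ?thesis
    using K by (intro exI[of _ K]) auto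
qed

text \<open>Induction on \<open>k\<close>: \<open>G x\<close> is at least \<open>G (x / 2)\<close>
  plus \<open>x / 2 * F x\<close>. As \<open>F (x / 2)\<close> is close to \<open>2 * F x\<close>,
  the first part nearly preserves the factor \<open>k / 4\<close>, and the second adds 1/2. Half of
  this gain pays for the approximation, the other half raises \<open>k\<close> by one.\<close>

lemma F_div_G: "((\<lambda>x. x * F x / G x) \<longlongrightarrow> 0) at_top"
proof -
  have ev: "\<forall>\<^sub>F x in at_top. (real k / 4) * (x * F x) \<le> G x" for k
  proof (induction k)
    case 0
    show ?case
      using eventually_ge_at_top[of 0] by eventually_elim (simp add: G_nonneg)
  next
    case (Suc k)
    have half: "filterlim (\<lambda>x::real. (1 / 2) * x) at_top at_top"
      by (rule filterlim_tendsto_pos_mult_at_top[OF tendsto_const]) (auto intro: filterlim_ident)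
    \<comment> \<open>The tolerance depends on \<open>k\<close>: with this lower bound as
      \<open>r\<close>, the loss \<open>k / 4 - k / 8 * r\<close> equals
      \<open>k / (4 * (k + 1))\<close>, which is at most 1/4.\<close>
    have "\<forall>\<^sub>F x in at_top. 2 - 2 / (real k + 1) < F ((1 / 2) * x) / F x"
      using F_ratio[of "1 / 2"] by (intro order_tendstoD(1)[of _ 2]) auto
    moreover have "\<forall>\<^sub>F x in at_top. (real k / 4) * ((1 / 2) * x * F ((1 / 2) * x)) \<le> G ((1 / 2) * x)"
      using eventually_compose_filterlim[OF Suc.IH half] by simp
    ultimately show ?case
      using eventually_gt_at_top[of 0]
    proof eventually_elim
      case (elim x)
      define r where "r = 2 - 2 / (real k + 1)"
      have F2: "r * F x \<le> F ((1 / 2) * x)"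
        using elim(1) F_pos[of x] by (simp add: r_def field_simps)
      have "(real k / 8) * x * (r * F x) \<le> (real k / 8) * x * F ((1 / 2) * x)"
        using F2 elim by (intro mult_left_mono) auto
      then have "(real k / 8) * x * (r * F x) + x / 2 * F x \<le> G ((1 / 2) * x) + x / 2 * F x"
        using elim(2) by (simp add: mult_ac)
      also have "\<dots> \<le> G x"
        using G_diff(1)[of "(1/2) * x" x] elim(3) by simp
      finally have "(real k / 8 * r + 1 / 2) * (x * F x) \<le> G x"
        by (simp add: algebra_simps)
      moreover have "real (Suc k) / 4 \<le> real k / 8 * r + 1 / 2"
        by (simp add: r_def field_simps)
      then have "real (Suc k) / 4 * (x * F x) \<le> (real k / 8 * r + 1 / 2) * (x * F x)"
        using elim F_nonneg by (intro mult_right_mono) auto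
      ultimately show ?case by linarith
    qed
  qed
  show ?thesis
  proof (rule tendstoI)
    fix e :: real assume "0 < e"
    then obtain k where k: "4 / e < real k"
      using reals_Archimedean2 by blast
    show "\<forall>\<^sub>F x in at_top. dist (x * F x / G x) 0 < e"
      using ev[of k] eventually_gt_at_top[of 0]
    proof eventually_elim
      case (elim x)
      have pos: "0 < x * F x"
        using elim F_pos by simp
      have "0 < G x"
        using G_ge[of x] pos elim by linarith
      have "4 < e * real k"
        using k \<open>0 < e\<close> by (simp add: field_simps)
      then have "4 * (x * F x) < e * real k * (x * F x)"
        using pos by (intro mult_strict_right_mono) auto
      also have "\<dots> \<le> e * (4 * G x)"
        using elim \<open>0 < e\<close> by (simp add: mult.assoc)
      finally show ?case
        using \<open>0 < G x\<close> pos by (simp add: field_simps)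
    qed
  qed
qed

lemma G_pos: "0 < x \<Longrightarrow> 0 < G x"
  using G_ge[of x] F_pos[of x] mult_pos_pos[of x "F x"] by linarith

text \<open>From \<open>y \<ge> c n G y \<ge> c n y F y\<close> one gets
  \<open>c n F y \<le> 1\<close>, impossible for bounded \<open>y\<close> once \<open>n\<close> is
  large, since \<open>F\<close> is positive and nonincreasing. The filter is arbitrary so that pairs
  \<open>(n, y)\<close> and subsequences are treated alike.\<close>

lemma scale_at_top:
  fixes n :: "'i \<Rightarrow> nat" and y :: "'i \<Rightarrow> real"
  assumes n: "filterlim n at_top \<Phi>" and y: "\<forall>\<^sub>F i in \<Phi>. 0 < y i"
    and c: "0 < c" "\<forall>\<^sub>F i in \<Phi>. c * real (n i) * G (y i) \<le> y i"
  shows "filterlim y at_top \<Phi>"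
  unfolding filterlim_at_top
proof
  fix Y :: real
  have "\<forall>\<^sub>F i in \<Phi>. 1 / (c * F Y) < real (n i)"
    using filterlim_compose[OF filterlim_real_sequentially n]
    by (simp add: filterlim_at_top_dense)
  then show "\<forall>\<^sub>F i in \<Phi>. Y \<le> y i"
    using y c(2)
  proof eventually_elim
    case (elim i)
    show "Y \<le> y i"
    proof (rule ccontr)
      assume "\<not> Y \<le> y i"
      then have "y i * F Y \<le> y i * F (y i)"
        using elim by (intro mult_left_mono F_antimono) auto
      also have "\<dots> \<le> G (y i)"
        using elim by (intro G_ge) auto
      finally have "c * real (n i) * (y i * F Y) \<le> c * real (n i) * G (y i)"
        using c by (intro mult_left_mono) auto
      then have "y i * (c * real (n i) * F Y) \<le> y i * 1"
        using elim(3) by (simp only: mult_ac mult_1_right)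
      then have "c * real (n i) * F Y \<le> 1"
        using elim(2) by (simp only: mult_le_cancel_left_pos)
      with elim(1) show False
        using c F_pos[of Y] by (simp add: field_simps)
    qed
  qed
qed

end

subsection \<open>Centred asymptotics\<close>

context nonneg_iid
begin

text \<open>The jump bounds with \<open>b = t = d * y\<close> and \<open>s = a * y\<close>; the
  hypothesis on \<open>V\<close> bounds the atypical probability by
  \<open>(1 + K) n F (d y)\<close>. In the upper bound \<open>G (d y) \<le> G y\<close> makes the
  centring harmless, so only \<open>t\<close> is lost. In the lower bound the centring error is at
  most \<open>G y + n y F (d y)\<close>, hence at most \<open>d * y\<close>; together with
  \<open>t\<close> this shifts \<open>a\<close> to \<open>a + 2 * d\<close>.\<close>

lemma
  assumes "0 < n" "0 < y" "0 < d" "d \<le> 1" "0 < a"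
    and V: "V (d * y) \<le> K * (d * y)\<^sup>2 * F (d * y)"
  shows tailFn_shifted_upper: "tailFn M \<xi> n (real n * G y + a * y) \<le>
      real n * (F ((a - d) * y) + F (d * y) * ((1 + K) * (real n * F (d * y)))
        + K * d\<^sup>2 / a\<^sup>2 * F (d * y))" (is ?upper)
    and tailFn_shifted_lower: "G y + real n * y * F (d * y) \<le> d * y \<Longrightarrow>
      (1 + K) * (real n * F (d * y)) \<le> 1 \<Longrightarrow>
      real n * (F ((a + 2 * d) * y) * (1 - (1 + K) * (real n * F (d * y))))
        \<le> tailFn M \<xi> n (real n * G y + a * y)" (is "_ \<Longrightarrow> _ \<Longrightarrow> ?lower")
proof -
  let ?b = "d * y" and ?z = "real n * G y + a * y"
  have b: "0 < ?b" "?b \<le> y"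
    using assms by auto
  have G: "G ?b \<le> G y" "0 \<le> G ?b"
    using b by (auto intro: G_mono G_nonneg)
  have "V ?b / ?b\<^sup>2 \<le> K * F ?b"
    by (subst pos_divide_le_eq) (use V b in \<open>auto simp: mult_ac\<close>)
  then have "real n * (V ?b / ?b\<^sup>2) \<le> real n * (K * F ?b)"
    by (intro mult_left_mono) auto
  then have rho: "real n * F ?b + real n * V ?b / ?b\<^sup>2 \<le> (1 + K) * (real n * F ?b)"
    by (simp add: algebra_simps)
  have "real (n - 1) * G ?b \<le> real n * G y"
    using G by (intro mult_mono) auto
  then have z: "(a - d) * y \<le> ?z - real (n - 1) * G ?b - ?b"
    "?b \<le> ?z - real (n - 1) * G ?b + ?b"
    using assms by (auto simp: algebra_simps add_increasing)
  have "real n * V ?b / (a * y)\<^sup>2 \<le> real n * (K * ?b\<^sup>2 * F ?b) / (a * y)\<^sup>2"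
    using V by (intro divide_right_mono mult_left_mono) auto
  also have "\<dots> = real n * (K * d\<^sup>2 / a\<^sup>2 * F ?b)"
    using assms by (simp add: power_mult_distrib field_simps)
  finally have third: "real n * V ?b / (a * y)\<^sup>2 \<le> real n * (K * d\<^sup>2 / a\<^sup>2 * F ?b)" .
  have "real n * G ?b \<le> real n * G y"
    using G by (intro mult_left_mono) auto
  then have "tailFn M \<xi> n ?z \<le> real n * F (?z - real (n - 1) * G ?b - ?b)
    + real n * F ?b * (real n * F ?b + real n * V ?b / ?b\<^sup>2) + real n * V ?b / (a * y)\<^sup>2"
    using b assms by (intro tailFn_upper) auto
  also have "\<dots> \<le> real n * F ((a - d) * y) + real n * F ?b * ((1 + K) * (real n * F ?b))
      + real n * (K * d\<^sup>2 / a\<^sup>2 * F ?b)"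
    using rho z(1) third F_nonneg F_antimono by (intro add_mono mult_left_mono) auto
  finally show ?upper
    by (simp add: algebra_simps)
  assume close: "G y + real n * y * F ?b \<le> d * y" and small: "(1 + K) * (real n * F ?b) \<le> 1"
  have "G y - G ?b \<le> (y - ?b) * F ?b"
    using b by (intro G_diff) auto
  also have "\<dots> \<le> y * F ?b"
    using b F_nonneg by (intro mult_right_mono) auto
  finally have "real n * (G y - G ?b) \<le> real n * (y * F ?b)"
    by (intro mult_left_mono) auto
  then have "real n * G y - real (n - 1) * G ?b \<le> d * y"
    using close G assms(1) by (simp add: algebra_simps)
  then have "F ((a + 2 * d) * y) \<le> F (?z - real (n - 1) * G ?b + ?b)"
    by (intro F_antimono) (simp add: algebra_simps)
  then have "real n * F ((a + 2 * d) * y) * (1 - (1 + K) * (real n * F ?b))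
      \<le> real n * F (?z - real (n - 1) * G ?b + ?b) * (1 - (real n * F ?b + real n * V ?b / ?b\<^sup>2))"
    using rho small F_nonneg by (intro mult_mono mult_left_mono) auto
  also have "\<dots> \<le> tailFn M \<xi> n ?z"
    using b z by (intro tailFn_lower) auto
  finally show ?lower
    by (simp only: mult.assoc)
qed

end

context slowly_varying_iid
begin

text \<open>The scale condition gives \<open>n F y \<le> y F y / (c G y)\<close>, which vanishes by
  \<open>F_div_G\<close>, and \<open>G y / y \<le> 1 / (c n)\<close>. Regular variation of
  \<open>F\<close> carries the first limit from \<open>y\<close> to \<open>d * y\<close>.\<close>

lemma
  fixes n :: "'i \<Rightarrow> nat" and y :: "'i \<Rightarrow> real"
  assumes n: "filterlim n at_top \<Phi>" and y: "\<forall>\<^sub>F i in \<Phi>. 0 < y i"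
    and c: "0 < c" "\<forall>\<^sub>F i in \<Phi>. c * real (n i) * G (y i) \<le> y i"
  shows scaled_F_tendsto_0: "0 < d \<Longrightarrow> ((\<lambda>i. real (n i) * F (d * y i)) \<longlongrightarrow> 0) \<Phi>"
    and scaled_G_tendsto_0: "((\<lambda>i. G (y i) / y i) \<longlongrightarrow> 0) \<Phi>"
proof -
  note y_top = scale_at_top[OF assms]
  have "((\<lambda>i. (1 / c) * (y i * F (y i) / G (y i))) \<longlongrightarrow> (1 / c) * 0) \<Phi>"
    by (intro tendsto_mult tendsto_const filterlim_compose[OF F_div_G y_top])
  then have 1: "((\<lambda>i. (1 / c) * (y i * F (y i) / G (y i))) \<longlongrightarrow> 0) \<Phi>"
    by simp
  have 2: "\<forall>\<^sub>F i in \<Phi>. real (n i) * F (y i) \<le> (1 / c) * (y i * F (y i) / G (y i))"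
    using y c(2)
  proof eventually_elim
    case (elim i)
    have "F (y i) * (c * real (n i) * G (y i)) \<le> F (y i) * y i"
      using elim F_nonneg by (intro mult_left_mono) auto
    then show ?case
      using c(1) G_pos[OF elim(1)] by (simp add: field_simps)
  qed
  have nF: "((\<lambda>i. real (n i) * F (y i)) \<longlongrightarrow> 0) \<Phi>"
    by (rule tendsto_sandwich[OF _ 2 tendsto_const 1]) (simp add: F_nonneg)
  show "((\<lambda>i. real (n i) * F (d * y i)) \<longlongrightarrow> 0) \<Phi>" if "0 < d"
  proof -
    have "((\<lambda>i. (F (d * y i) / F (y i)) * (real (n i) * F (y i))) \<longlongrightarrow> (1 / d) * 0) \<Phi>"
      using that by (intro tendsto_mult nF filterlim_compose[OF F_ratio y_top])
    moreover have "(F (d * y i) / F (y i)) * (real (n i) * F (y i)) = real (n i) * F (d * y i)" for i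
      using F_pos[of "y i"] by simp
    ultimately show ?thesis by simp
  qed
  have 3: "((\<lambda>i. (1 / c) * inverse (real (n i))) \<longlongrightarrow> 0) \<Phi>"
    by (intro tendsto_mult_right_zero tendsto_inverse_0_at_top
        filterlim_compose[OF filterlim_real_sequentially n])
  have n0: "\<forall>\<^sub>F i in \<Phi>. 0 < n i"
    by (rule eventually_compose_filterlim[OF eventually_gt_at_top n])
  have 4: "\<forall>\<^sub>F i in \<Phi>. G (y i) / y i \<le> (1 / c) * inverse (real (n i))"
    using y c(2) n0 by eventually_elim (use c(1) in \<open>simp add: field_simps\<close>)
  have 5: "\<forall>\<^sub>F i in \<Phi>. 0 \<le> G (y i) / y i"
    using y by eventually_elim (simp add: G_nonneg)
  show "((\<lambda>i. G (y i) / y i) \<longlongrightarrow> 0) \<Phi>"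
    by (rule tendsto_sandwich[OF 5 4 tendsto_const 3])
qed

text \<open>For fixed \<open>d\<close> the ratio is squeezed between two expressions whose limits
  are \<open>?D d\<close> and \<open>?U d\<close>; both tend to 1 as \<open>d\<close> tends to 0.
  Uniformity in \<open>y\<close> is encoded in the filter.\<close>

theorem tailFn_shifted_asymp:
  fixes n :: "'i \<Rightarrow> nat" and y a :: "'i \<Rightarrow> real"
  assumes n: "filterlim n at_top \<Phi>" and y: "\<forall>\<^sub>F i in \<Phi>. 0 < y i"
    and c: "0 < c" "\<forall>\<^sub>F i in \<Phi>. c * real (n i) * G (y i) \<le> y i"
    and a: "(a \<longlongrightarrow> L) \<Phi>" "0 < L"
  shows "((\<lambda>i. tailFn M \<xi> (n i) (real (n i) * G (y i) + a i * y i)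
      / (real (n i) * F (a i * y i))) \<longlongrightarrow> 1) \<Phi>"
proof -
  note y_top = scale_at_top[OF n y c]
  note nF = scaled_F_tendsto_0[OF n y c]
  note Gy = scaled_G_tendsto_0[OF n y c]
  have n0: "\<forall>\<^sub>F i in \<Phi>. 0 < n i"
    by (rule eventually_compose_filterlim[OF eventually_gt_at_top n])
  obtain K where K: "0 \<le> K" "\<forall>\<^sub>F x in at_top. V x \<le> K * x\<^sup>2 * F x"
    using V_bound by auto
  let ?r = "\<lambda>i. tailFn M \<xi> (n i) (real (n i) * G (y i) + a i * y i) / (real (n i) * F (a i * y i))"
  \<comment> \<open>Once \<open>a i\<close> is within \<open>d\<close> of \<open>L\<close>,
    monotonicity of \<open>F\<close> replaces \<open>a i - d\<close> by \<open>L - 2 * d\<close>,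
    \<open>a i + 2 * d\<close> by \<open>L + 3 * d\<close>, and the \<open>a i\<close> in the
    denominator by \<open>L + d\<close> or \<open>L - d\<close>. The second summand uses
    \<open>a i \<ge> L / 2\<close>; its \<open>d\<^sup>2\<close> loses one factor to the limit
    \<open>(L + d) / d\<close> of \<open>F (d y) / F ((L + d) y)\<close>.\<close>
  let ?U = "\<lambda>d. (L + d) / (L - 2 * d) + 4 * K * d * (L + d) / L\<^sup>2"
  let ?D = "\<lambda>d. (L - d) / (L + 3 * d)"
  have ev: "\<forall>\<^sub>F i in \<Phi>. ?D d - e < ?r i \<and> ?r i < ?U d + e"
    if d: "0 < d" "d \<le> 1" "4 * d < L" and e: "0 < e" for d e
  proof -
    let ?ratio = "\<lambda>p q i. F (p * y i) / F (q * y i)"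
    have ratio: "(?ratio p q \<longlongrightarrow> q / p) \<Phi>" if "0 < p" "0 < q" for p q
      using filterlim_compose[OF F_ratio2[OF that] y_top] .
    let ?up = "\<lambda>i. ?ratio (L - 2 * d) (L + d) i
      + ?ratio d (L + d) i * ((1 + K) * (real (n i) * F (d * y i)))
      + 4 * K * d\<^sup>2 / L\<^sup>2 * ?ratio d (L + d) i"
    let ?lo = "\<lambda>i. ?ratio (L + 3 * d) (L - d) i * (1 - (1 + K) * (real (n i) * F (d * y i)))"
    have "(?up \<longlongrightarrow> (L + d) / (L - 2 * d) + (L + d) / d * ((1 + K) * 0) + 4 * K * d\<^sup>2 / L\<^sup>2 * ((L + d) / d)) \<Phi>"
      using d a(2) by (intro tendsto_add tendsto_mult tendsto_const ratio nF) auto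
    moreover have "4 * K * d\<^sup>2 / L\<^sup>2 * ((L + d) / d) = 4 * K * d * (L + d) / L\<^sup>2"
      using d by (simp add: power2_eq_square)
    ultimately have up: "\<forall>\<^sub>F i in \<Phi>. ?up i < ?U d + e"
      using e by (intro order_tendstoD(2)) auto
    have "(?lo \<longlongrightarrow> (L - d) / (L + 3 * d) * (1 - (1 + K) * 0)) \<Phi>"
      using d a(2) by (intro tendsto_diff tendsto_mult tendsto_const ratio nF) auto
    then have lo: "\<forall>\<^sub>F i in \<Phi>. ?D d - e < ?lo i"
      using e by (intro order_tendstoD(1)) auto
    have "((\<lambda>i. G (y i) / y i + real (n i) * F (d * y i)) \<longlongrightarrow> 0 + 0) \<Phi>"
      using d by (intro tendsto_add Gy nF) auto
    \<comment> \<open>This is the centring hypothesis of \<open>tailFn_shifted_lower\<close> divided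
      by \<open>y\<close>.\<close>
    then have close: "\<forall>\<^sub>F i in \<Phi>. G (y i) / y i + real (n i) * F (d * y i) < d"
      using d by (intro order_tendstoD(2)) auto
    have "((\<lambda>i. (1 + K) * (real (n i) * F (d * y i))) \<longlongrightarrow> (1 + K) * 0) \<Phi>"
      using d by (intro tendsto_mult tendsto_const nF) auto
    then have small: "\<forall>\<^sub>F i in \<Phi>. (1 + K) * (real (n i) * F (d * y i)) < 1"
      by (intro order_tendstoD(2)) auto
    have "filterlim (\<lambda>i. d * y i) at_top \<Phi>"
      using d by (intro filterlim_tendsto_pos_mult_at_top[OF tendsto_const _ y_top])
    then have V: "\<forall>\<^sub>F i in \<Phi>. V (d * y i) \<le> K * (d * y i)\<^sup>2 * F (d * y i)"
      by (rule eventually_compose_filterlim[OF K(2)])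
    have near: "\<forall>\<^sub>F i in \<Phi>. L - d < a i" "\<forall>\<^sub>F i in \<Phi>. a i < L + d"
      using d by (auto intro!: order_tendstoD[OF a(1)])
    show ?thesis
      using y n0 up lo close small V near
    proof eventually_elim
      case (elim i)
      let ?N = "real (n i)" and ?z = "real (n i) * G (y i) + a i * y i"
      let ?b = "F (d * y i)"
      have ai: "0 < a i" "L / 2 \<le> a i" and N: "0 < ?N"
        using elim d by auto
      note Fi = F_pos[of "a i * y i"]
      have mono: "F (p * y i) \<le> F (q * y i)" if "q \<le> p" for p q
        using that elim by (intro F_antimono mult_right_mono) auto
      have "tailFn M \<xi> (n i) ?z \<le> ?N * (F ((a i - d) * y i) + ?b * ((1 + K) * (?N * ?b))
        + K * d\<^sup>2 / (a i)\<^sup>2 * ?b)"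
        using elim d ai by (intro tailFn_shifted_upper) auto
      then have "?r i \<le> (F ((a i - d) * y i) + ?b * ((1 + K) * (?N * ?b))
        + K * d\<^sup>2 / (a i)\<^sup>2 * ?b) / F (a i * y i)"
        using N Fi by (simp add: field_simps)
      also have "\<dots> \<le> (F ((L - 2 * d) * y i) + ?b * ((1 + K) * (?N * ?b))
        + 4 * K * d\<^sup>2 / L\<^sup>2 * ?b) / F ((L + d) * y i)"
      proof (rule frac_le)
        have "(L / 2)\<^sup>2 \<le> (a i)\<^sup>2"
          using ai a(2) by (intro power_mono) auto
        then have "K * d\<^sup>2 / (a i)\<^sup>2 \<le> K * d\<^sup>2 / (L / 2)\<^sup>2"
          using K ai a(2) by (intro divide_left_mono) auto
        then have "K * d\<^sup>2 / (a i)\<^sup>2 \<le> 4 * K * d\<^sup>2 / L\<^sup>2"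
          by (simp add: power2_eq_square field_simps)
        then have "K * d\<^sup>2 / (a i)\<^sup>2 * ?b \<le> 4 * K * d\<^sup>2 / L\<^sup>2 * ?b"
          by (intro mult_right_mono F_nonneg)
        then show "F ((a i - d) * y i) + ?b * ((1 + K) * (?N * ?b)) + K * d\<^sup>2 / (a i)\<^sup>2 * ?b
            \<le> F ((L - 2 * d) * y i) + ?b * ((1 + K) * (?N * ?b)) + 4 * K * d\<^sup>2 / L\<^sup>2 * ?b"
          using elim by (intro add_mono mono) auto
        show "F ((L + d) * y i) \<le> F (a i * y i)"
          using elim by (intro mono) auto
        show "0 \<le> F ((L - 2 * d) * y i) + ?b * ((1 + K) * (?N * ?b)) + 4 * K * d\<^sup>2 / L\<^sup>2 * ?b"
          using K F_nonneg by (intro add_nonneg_nonneg mult_nonneg_nonneg divide_nonneg_nonneg) auto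
      qed (rule F_pos)
      also have "\<dots> = ?up i"
        by (simp add: add_divide_distrib)
      finally have up_i: "?r i \<le> ?up i" .
      have "?lo i = (F ((L + 3 * d) * y i) * (1 - (1 + K) * (?N * ?b))) / F ((L - d) * y i)"
        by simp
      also have "\<dots> \<le> (F ((a i + 2 * d) * y i) * (1 - (1 + K) * (?N * ?b))) / F (a i * y i)"
      proof (intro frac_le mult_right_mono)
        show "F ((L + 3 * d) * y i) \<le> F ((a i + 2 * d) * y i)" "F (a i * y i) \<le> F ((L - d) * y i)"
          using elim by (auto intro!: mono)
      qed (use elim F_nonneg F_pos in auto)
      also have "\<dots> = ?N * (F ((a i + 2 * d) * y i) * (1 - (1 + K) * (?N * ?b))) / (?N * F (a i * y i))"
        using N by simp
      also have "\<dots> \<le> ?r i"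
      proof (intro divide_right_mono tailFn_shifted_lower)
        have "(G (y i) / y i + ?N * ?b) * y i \<le> d * y i"
          using elim by (intro mult_right_mono) auto
        then show "G (y i) + ?N * y i * ?b \<le> d * y i"
          using elim(1) by (simp add: algebra_simps)
      qed (use elim d ai Fi in auto)
      finally show ?case
        using up_i elim by linarith
    qed
  qed
  show ?thesis
  proof (rule tendstoI)
    fix e :: real assume "0 < e"
    have "(?U \<longlongrightarrow> (L + 0) / (L - 2 * 0) + 4 * K * 0 * (L + 0) / L\<^sup>2) (at_right 0)"
      using a(2) by (intro tendsto_intros) auto
    then have 1: "\<forall>\<^sub>F d in at_right 0. ?U d < 1 + e / 2"
      using a(2) \<open>0 < e\<close> by (intro order_tendstoD(2)) auto
    have "(?D \<longlongrightarrow> (L - 0) / (L + 3 * 0)) (at_right 0)"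
      using a(2) by (intro tendsto_intros) auto
    then have 2: "\<forall>\<^sub>F d in at_right 0. 1 - e / 2 < ?D d"
      using a(2) \<open>0 < e\<close> by (intro order_tendstoD(1)) auto
    have 3: "\<forall>\<^sub>F d in at_right (0::real). 0 < d \<and> d < min 1 (L / 4)"
      using a(2) by (auto simp: eventually_at_right_less intro!: eventually_conj eventually_at_rightI[of 0 "min 1 (L / 4)"])
    obtain d where d: "?U d < 1 + e / 2" "1 - e / 2 < ?D d" "0 < d" "d < 1" "4 * d < L"
      using eventually_happens[OF eventually_conj[OF 1 eventually_conj[OF 2 3]]] by auto
    have "\<forall>\<^sub>F i in \<Phi>. ?D d - e / 2 < ?r i \<and> ?r i < ?U d + e / 2"
      using d \<open>0 < e\<close> by (intro ev) auto
    then show "\<forall>\<^sub>F i in \<Phi>. dist (?r i) 1 < e"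
      by eventually_elim (use d in \<open>auto simp: dist_real_def\<close>)
  qed
qed

end

subsection \<open>Uniform convergence along index-dependent sets\<close>

text \<open>The filter of pairs \<open>(n, y)\<close> with \<open>n\<close> tending to infinity and
  \<open>y \<in> S n\<close>: a limit along it is a limit uniform over the sets \<open>S n\<close>,
  so uniform statements inherit the usual limit calculus.\<close>

definition indexed_points :: "(nat \<Rightarrow> real set) \<Rightarrow> (nat \<times> real) filter" where
  "indexed_points S = inf (filtercomap fst sequentially) (principal {p. snd p \<in> S (fst p)})"

lemma eventually_indexed_points:
  "eventually P (indexed_points S) \<longleftrightarrow> (\<forall>\<^sub>F n in sequentially. \<forall>y\<in>S n. P (n, y))"
  unfolding indexed_points_def eventually_inf_principal eventually_filtercomap
proof
  assume "\<exists>Q. eventually Q sequentially \<and> (\<forall>p. Q (fst p) \<longrightarrow> p \<in> {p. snd p \<in> S (fst p)} \<longrightarrow> P p)"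
  then obtain Q where "eventually Q sequentially" and Q: "\<And>p. Q (fst p) \<Longrightarrow> snd p \<in> S (fst p) \<Longrightarrow> P p"
    by auto
  then show "\<forall>\<^sub>F n in sequentially. \<forall>y\<in>S n. P (n, y)"
    by (auto elim!: eventually_mono)
next
  assume "\<forall>\<^sub>F n in sequentially. \<forall>y\<in>S n. P (n, y)"
  moreover have "\<forall>p. (\<forall>y\<in>S (fst p). P (fst p, y)) \<longrightarrow> p \<in> {p. snd p \<in> S (fst p)} \<longrightarrow> P p"
    by simp
  ultimately show "\<exists>Q. eventually Q sequentially \<and> (\<forall>p. Q (fst p) \<longrightarrow> p \<in> {p. snd p \<in> S (fst p)} \<longrightarrow> P p)"
    by blast
qed

lemma filterlim_fst_indexed_points: "filterlim fst at_top (indexed_points S)"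
  unfolding indexed_points_def
  by (rule filterlim_mono[OF filterlim_filtercomap order_refl inf_le1])

text \<open>Nonemptiness excludes the supremum of the empty set, which is minus infinity in
  \<open>ereal\<close> and would spoil the limit 0.\<close>

lemma SUP_abs_tendsto_0_iff:
  fixes g :: "nat \<Rightarrow> real \<Rightarrow> real"
  assumes "\<forall>\<^sub>F n in sequentially. S n \<noteq> {}"
  shows "((\<lambda>n. SUP y\<in>S n. ereal \<bar>g n y - l\<bar>) \<longlonglongrightarrow> 0) \<longleftrightarrow>
    ((\<lambda>p. g (fst p) (snd p)) \<longlongrightarrow> l) (indexed_points S)"
proof
  assume lim: "(\<lambda>n. SUP y\<in>S n. ereal \<bar>g n y - l\<bar>) \<longlonglongrightarrow> 0"
  show "((\<lambda>p. g (fst p) (snd p)) \<longlongrightarrow> l) (indexed_points S)"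
  proof (rule tendstoI)
    fix e :: real assume "0 < e"
    then have "\<forall>\<^sub>F n in sequentially. (SUP y\<in>S n. ereal \<bar>g n y - l\<bar>) < ereal e"
      by (intro order_tendstoD(2)[OF lim]) auto
    then show "\<forall>\<^sub>F p in indexed_points S. dist (g (fst p) (snd p)) l < e"
      unfolding eventually_indexed_points
    proof (rule eventually_mono, intro ballI)
      fix n y assume n: "(SUP y\<in>S n. ereal \<bar>g n y - l\<bar>) < ereal e" "y \<in> S n"
      then have "ereal \<bar>g n y - l\<bar> \<le> (SUP y\<in>S n. ereal \<bar>g n y - l\<bar>)"
        by (intro SUP_upper)
      with n(1) have "ereal \<bar>g n y - l\<bar> < ereal e"
        by (rule order.strict_trans1[rotated])
      then show "dist (g (fst (n, y)) (snd (n, y))) l < e"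
        by (simp add: dist_real_def)
    qed
  qed
next
  assume lim: "((\<lambda>p. g (fst p) (snd p)) \<longlongrightarrow> l) (indexed_points S)"
  show "(\<lambda>n. SUP y\<in>S n. ereal \<bar>g n y - l\<bar>) \<longlonglongrightarrow> 0"
  proof (rule order_tendstoI)
    fix a :: ereal assume "a < 0"
    show "\<forall>\<^sub>F n in sequentially. a < (SUP y\<in>S n. ereal \<bar>g n y - l\<bar>)"
      using assms
    proof eventually_elim
      case (elim n)
      then obtain y where "y \<in> S n" by auto
      note \<open>a < 0\<close>
      also have "0 \<le> ereal \<bar>g n y - l\<bar>" by simp
      also have "\<dots> \<le> (SUP y\<in>S n. ereal \<bar>g n y - l\<bar>)"
        using \<open>y \<in> S n\<close> by (intro SUP_upper)
      finally show ?case .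
    qed
  next
    fix a :: ereal assume "0 < a"
    then obtain e where e: "0 < ereal e" "ereal e < a"
      using ereal_dense2 by blast
    then have "\<forall>\<^sub>F p in indexed_points S. dist (g (fst p) (snd p)) l < e"
      by (intro tendstoD[OF lim]) auto
    then show "\<forall>\<^sub>F n in sequentially. (SUP y\<in>S n. ereal \<bar>g n y - l\<bar>) < a"
      unfolding eventually_indexed_points
    proof eventually_elim
      case (elim n)
      then have "(SUP y\<in>S n. ereal \<bar>g n y - l\<bar>) \<le> ereal e"
        by (intro SUP_least) (auto simp: dist_real_def less_imp_le)
      with e(2) show ?case by (rule order.strict_trans1[rotated])
    qed
  qed
qed

section \<open>The three regimes: statements (a), (b) and (c)\<close>

context slowly_varying_iid
begin

text \<open>Since \<open>x / G x\<close> is nondecreasing, a scale condition known at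
  \<open>x n\<close> extends to every \<open>y \<ge> x n\<close>.\<close>

lemma G_ratio_mono:
  assumes "0 < x" "x \<le> y" "k * G x \<le> x"
  shows "k * G y \<le> y"
proof -
  have "G y * (k * G x) \<le> G y * x"
    using assms G_nonneg by (intro mult_left_mono) auto
  also have "\<dots> \<le> y * G x"
    using G_concave[of x y] assms by (simp add: mult.commute)
  finally have "(k * G y) * G x \<le> y * G x"
    by (simp add: mult_ac)
  then show ?thesis
    using G_pos[OF assms(1)] by simp
qed

lemma F_tendsto_0: "(F \<longlongrightarrow> 0) at_top"
proof (rule tendsto_sandwich[OF _ _ tendsto_const F_div_G])
  show "\<forall>\<^sub>F x in at_top. 0 \<le> F x"
    by (intro always_eventually allI F_nonneg)
  show "\<forall>\<^sub>F x in at_top. F x \<le> x * F x / G x"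
    using eventually_gt_at_top[of 0]
  proof eventually_elim
    case (elim x)
    have "F x * G x \<le> F x * x"
      using elim G_le[of x] F_nonneg by (intro mult_left_mono) auto
    then show ?case
      using G_pos[OF elim] by (simp add: field_simps)
  qed
qed

text \<open>Monotonicity of \<open>F\<close> stands in for the uniform convergence theorem:
  \<open>F (a y)\<close> is compared with \<open>F (p y)\<close> for a fixed \<open>p\<close>
  slightly above or below \<open>L\<close>.\<close>

lemma F_ratio_tendsto:
  assumes a: "(a \<longlongrightarrow> L) \<Phi>" "0 < L" and y: "filterlim y at_top \<Phi>"
  shows "((\<lambda>i. F (a i * y i) / F (y i)) \<longlongrightarrow> 1 / L) \<Phi>"
proof -
  have y0: "\<forall>\<^sub>F i in \<Phi>. 0 < y i"
    using y by (simp add: filterlim_at_top_dense)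
  show ?thesis
  proof (rule order_tendstoI)
    fix u :: real assume "u < 1 / L"
    have "((\<lambda>p. 1 / p) \<longlongrightarrow> 1 / L) (at_right L)"
      using a(2) by (intro tendsto_intros) auto
    from order_tendstoD(1)[OF this \<open>u < 1 / L\<close>] obtain p where p: "L < p" "u < 1 / p"
      using eventually_happens[OF eventually_conj[OF _ eventually_at_right_less[of L]]] by auto
    have "\<forall>\<^sub>F i in \<Phi>. u < F (p * y i) / F (y i)"
      using p a(2) by (intro order_tendstoD(1)[OF filterlim_compose[OF F_ratio y]]) auto
    moreover have "\<forall>\<^sub>F i in \<Phi>. a i < p"
      using order_tendstoD(2)[OF a(1) p(1)] .
    ultimately show "\<forall>\<^sub>F i in \<Phi>. u < F (a i * y i) / F (y i)"
      using y0
    proof eventually_elim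
      case (elim i)
      then have "F (p * y i) / F (y i) \<le> F (a i * y i) / F (y i)"
        by (intro divide_right_mono F_antimono F_nonneg) auto
      with elim show ?case by linarith
    qed
  next
    fix v :: real assume "1 / L < v"
    have "((\<lambda>p. 1 / p) \<longlongrightarrow> 1 / L) (at_left L)"
      using a(2) by (intro tendsto_intros) auto
    from order_tendstoD(2)[OF this \<open>1 / L < v\<close>] obtain p where p: "0 < p" "p < L" "1 / p < v"
      using eventually_happens[OF eventually_conj[OF _ eventually_at_left_real[OF a(2)]]] by auto
    have "\<forall>\<^sub>F i in \<Phi>. F (p * y i) / F (y i) < v"
      using p by (intro order_tendstoD(2)[OF filterlim_compose[OF F_ratio y]]) auto
    moreover have "\<forall>\<^sub>F i in \<Phi>. p < a i"
      using order_tendstoD(1)[OF a(1) p(2)] .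
    ultimately show "\<forall>\<^sub>F i in \<Phi>. F (a i * y i) / F (y i) < v"
      using y0
    proof eventually_elim
      case (elim i)
      then have "F (a i * y i) / F (y i) \<le> F (p * y i) / F (y i)"
        by (intro divide_right_mono F_antimono F_nonneg) auto
      with elim show ?case by linarith
    qed
  qed
qed

lemma G_continuous: "continuous_on {0..} G"
proof -
  have le: "\<bar>G u - G v\<bar> \<le> \<bar>u - v\<bar>" if "0 \<le> u" "u \<le> v" for u v
    using G_diff(2)[OF that] G_mono[OF that] mult_left_mono[OF F_le_1[of u], of "v - u"] that by auto
  have "\<bar>G u - G v\<bar> \<le> \<bar>u - v\<bar>" if "0 \<le> u" "0 \<le> v" for u v
    using le[of u v] le[of v u] that by linarith
  then have "1-lipschitz_on {0..} G"
    by (intro lipschitz_onI) (auto simp: dist_real_def)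
  then show ?thesis
    by (rule lipschitz_on_continuous_on)
qed

text \<open>Intermediate values of \<open>y - k * G y\<close>: negative at \<open>x\<close>, and
  nonnegative far out because \<open>F\<close> tends to 0 and so \<open>G\<close> grows
  sublinearly.\<close>

lemma ex_scale:
  assumes "0 < x" "0 < k" "x < k * G x"
  shows "\<exists>y\<ge>x. y = k * G y"
proof -
  have "\<forall>\<^sub>F z in at_top. F z < 1 / (2 * k)"
    using assms by (intro order_tendstoD(2)[OF F_tendsto_0]) auto
  then obtain z where z: "0 < z" "F z < 1 / (2 * k)"
    using eventually_happens[OF eventually_conj[OF _ eventually_gt_at_top[of 0]]] by auto
  \<comment> \<open>The last entry makes \<open>k * G z\<close> at most \<open>Y / 2\<close>; by the
    choice of \<open>z\<close>, the increment of \<open>k * G\<close> from \<open>z\<close> to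
    \<open>Y\<close> is at most another \<open>Y / 2\<close>.\<close>
  define Y where "Y = max (max x z) (2 * k * G z)"
  have Y: "x \<le> Y" "z \<le> Y" "k * G z \<le> Y / 2"
    by (auto simp: Y_def)
  have "k * (G Y - G z) \<le> k * ((Y - z) * F z)"
    using G_diff(2)[of z Y] Y z assms by (intro mult_left_mono) auto
  also have "\<dots> \<le> k * (Y * (1 / (2 * k)))"
    using Y z F_nonneg assms by (intro mult_left_mono mult_mono) auto
  also have "\<dots> = Y / 2"
    using assms by simp
  finally have "k * G Y \<le> Y"
    using Y by (simp add: algebra_simps)
  moreover have "continuous_on {x..Y} (\<lambda>y. y - k * G y)"
    using assms by (intro continuous_intros continuous_on_subset[OF G_continuous]) auto
  ultimately show ?thesis
    using IVT'[of "\<lambda>y. y - k * G y" x 0 Y] assms Y by auto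
qed

lemma uniform_tail_if:
  assumes x: "\<forall>n\<ge>1. 0 < x n"
    and lim: "filterlim (\<lambda>n. x n / (real n * G (x n))) at_top sequentially"
  shows "(\<lambda>n. SUP y\<in>{x n..}. ereal \<bar>tailFn M \<xi> n y / (real n * F y) - 1\<bar>) \<longlonglongrightarrow> 0"
proof -
  let ?\<Phi> = "indexed_points (\<lambda>n. {x n..})"
  let ?a = "\<lambda>p. 1 - real (fst p) * G (snd p) / snd p"
  have pos: "\<forall>\<^sub>F p in ?\<Phi>. 0 < snd p \<and> 0 < fst p"
    unfolding eventually_indexed_points using eventually_ge_at_top[of 1]
    by eventually_elim (use x in force)
  have scale: "\<forall>\<^sub>F p in ?\<Phi>. B * real (fst p) * G (snd p) \<le> snd p" for B
  proof -
    have "\<forall>\<^sub>F n in sequentially. B \<le> x n / (real n * G (x n))"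
      using lim by (simp add: filterlim_at_top)
    then show ?thesis
      unfolding eventually_indexed_points using eventually_ge_at_top[of 1]
    proof eventually_elim
      case (elim n)
      then have "0 < x n" "0 < real n" "0 < G (x n)"
        using x G_pos by auto
      with elim(1) have "B * real n * G (x n) \<le> x n"
        by (simp add: field_simps)
      with \<open>0 < x n\<close> show ?case
        by (auto intro: G_ratio_mono)
    qed
  qed
  have scale1: "\<forall>\<^sub>F p in ?\<Phi>. 1 * real (fst p) * G (snd p) \<le> snd p"
    by (rule scale)
  have y0: "\<forall>\<^sub>F p in ?\<Phi>. 0 < snd p"
    using pos by (rule eventually_mono) auto
  note y_top = scale_at_top[OF filterlim_fst_indexed_points y0 zero_less_one scale1]
  have "((\<lambda>p. real (fst p) * G (snd p) / snd p) \<longlongrightarrow> 0) ?\<Phi>"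
  proof (rule tendstoI)
    fix e :: real assume "0 < e"
    show "\<forall>\<^sub>F p in ?\<Phi>. dist (real (fst p) * G (snd p) / snd p) 0 < e"
      using scale[of "2 / e"] y0
    proof eventually_elim
      case (elim p)
      have "real (fst p) * G (snd p) / snd p \<le> e / 2"
        using elim \<open>0 < e\<close> by (simp add: field_simps)
      also have "\<dots> < e"
        using \<open>0 < e\<close> by simp
      finally have "real (fst p) * G (snd p) / snd p < e" .
      moreover have "0 \<le> real (fst p) * G (snd p) / snd p"
        using elim G_nonneg by simp
      ultimately show ?case
        by (simp only: dist_real_def diff_0_right abs_of_nonneg)
    qed
  qed
  then have "(?a \<longlongrightarrow> 1 - 0) ?\<Phi>"
    by (intro tendsto_diff tendsto_const)
  then have a: "(?a \<longlongrightarrow> 1) ?\<Phi>" by simp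
  have "((\<lambda>p. tailFn M \<xi> (fst p) (real (fst p) * G (snd p) + ?a p * snd p)
      / (real (fst p) * F (?a p * snd p))) \<longlongrightarrow> 1) ?\<Phi>"
    by (rule tailFn_shifted_asymp[OF filterlim_fst_indexed_points y0 zero_less_one scale1 a zero_less_one])
  \<comment> \<open>As \<open>?a\<close> tends to 1, the extra factor replaces
    \<open>F (?a y)\<close> by \<open>F y\<close> without changing the limit.\<close>
  then have "((\<lambda>p. tailFn M \<xi> (fst p) (real (fst p) * G (snd p) + ?a p * snd p)
      / (real (fst p) * F (?a p * snd p)) * (F (?a p * snd p) / F (snd p))) \<longlongrightarrow> 1 * (1 / 1)) ?\<Phi>"
    by (intro tendsto_mult F_ratio_tendsto a y_top zero_less_one)
  moreover have "\<forall>\<^sub>F p in ?\<Phi>. tailFn M \<xi> (fst p) (real (fst p) * G (snd p) + ?a p * snd p)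
      / (real (fst p) * F (?a p * snd p)) * (F (?a p * snd p) / F (snd p))
      = tailFn M \<xi> (fst p) (snd p) / (real (fst p) * F (snd p))"
    using y0
  proof eventually_elim
    case (elim p)
    have "real (fst p) * G (snd p) + ?a p * snd p = snd p"
      using elim by (simp add: field_simps)
    moreover have "F (?a p * snd p) \<noteq> 0"
      using F_pos[of "?a p * snd p"] by linarith
    ultimately show ?case by simp
  qed
  ultimately have "((\<lambda>p. tailFn M \<xi> (fst p) (snd p) / (real (fst p) * F (snd p))) \<longlongrightarrow> 1 * (1 / 1)) ?\<Phi>"
    by (rule Lim_transform_eventually)
  then show ?thesis
    by (subst SUP_abs_tendsto_0_iff) auto
qed

text \<open>Along indices where \<open>x n / (n G(x n))\<close> stays below \<open>B\<close> one finds \<open>y \<ge> x n\<close> with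
  \<open>y = B n G(y)\<close>; at \<open>z = n G(y) + y = (1 + 1/B) y\<close> the centred asymptotics give \<open>n F(y)\<close>,
  which differs from \<open>n F(z)\<close> by the factor \<open>1 + 1/B\<close>.\<close>

lemma uniform_tail_only_if:
  assumes x: "\<forall>n\<ge>1. 0 < x n"
    and lim: "(\<lambda>n. SUP y\<in>{x n..}. ereal \<bar>tailFn M \<xi> n y / (real n * F y) - 1\<bar>) \<longlonglongrightarrow> 0"
  shows "filterlim (\<lambda>n. x n / (real n * G (x n))) at_top sequentially"
proof (rule ccontr)
  assume "\<not> ?thesis"
  then obtain Z where Z: "\<not> (\<forall>\<^sub>F n in sequentially. Z \<le> x n / (real n * G (x n)))"
    by (auto simp: filterlim_at_top)
  define B where "B = max Z 1"
  have B: "0 < B" by (simp add: B_def)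
  define A where "A = {n. 1 \<le> n \<and> \<not> B \<le> x n / (real n * G (x n))}"
  \<comment> \<open>The subsequence of bad indices, as a filter; it is proper because the quotient
    fails to stay above \<open>Z\<close> eventually, and \<open>B \<ge> Z\<close>.\<close>
  define \<Phi> where "\<Phi> = inf sequentially (principal A)"
  have "\<Phi> \<noteq> bot"
  proof
    assume "\<Phi> = bot"
    then have "\<forall>\<^sub>F n in sequentially. n \<notin> A"
      by (simp add: \<Phi>_def trivial_limit_def eventually_inf_principal)
    then have "\<forall>\<^sub>F n in sequentially. Z \<le> x n / (real n * G (x n))"
      using eventually_ge_at_top[of 1] by eventually_elim (auto simp: A_def B_def)
    with Z show False ..
  qed
  have inA: "\<forall>\<^sub>F n in \<Phi>. n \<in> A"
    by (simp add: \<Phi>_def eventually_inf_principal)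
  have n: "filterlim (\<lambda>n. n) at_top \<Phi>"
    unfolding \<Phi>_def by (rule filterlim_mono[OF filterlim_ident order_refl inf_le1])
  have "\<exists>y\<ge>x n. y = B * real n * G y" if "n \<in> A" for n
  proof (rule ex_scale)
    show "0 < x n"
      using that x by (auto simp: A_def)
    moreover from this have "0 < G (x n)" "0 < real n"
      using that G_pos by (auto simp: A_def)
    ultimately show "x n < B * real n * G (x n)" "0 < B * real n"
      using that B by (auto simp: A_def field_simps)
  qed
  then obtain y where y: "\<And>n. n \<in> A \<Longrightarrow> x n \<le> y n \<and> y n = B * real n * G (y n)"
    by metis
  have y_eq: "\<forall>\<^sub>F n in \<Phi>. B * real n * G (y n) = y n"
    using inA by eventually_elim (metis y)
  then have y_le: "\<forall>\<^sub>F n in \<Phi>. B * real n * G (y n) \<le> y n"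
    by (rule eventually_mono) auto
  have y0: "\<forall>\<^sub>F n in \<Phi>. 0 < y n"
    using inA
  proof eventually_elim
    case (elim n)
    then have "0 < x n" "x n \<le> y n"
      using x y by (auto simp: A_def)
    then show ?case by linarith
  qed
  note y_top = scale_at_top[OF n y0 B y_le]
  let ?w = "1 + 1 / B"
  have 1: "((\<lambda>n. tailFn M \<xi> n (real n * G (y n) + 1 * y n) / (real n * F (1 * y n))) \<longlongrightarrow> 1) \<Phi>"
    by (rule tailFn_shifted_asymp[OF n y0 B y_le tendsto_const]) simp
  have "((\<lambda>p. tailFn M \<xi> (fst p) (snd p) / (real (fst p) * F (snd p))) \<longlongrightarrow> 1) (indexed_points (\<lambda>n. {x n..}))"
    using lim by (subst (asm) SUP_abs_tendsto_0_iff) auto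
  \<comment> \<open>As \<open>?w \<ge> 1\<close>, the points \<open>?w * y n\<close> stay in the
    range \<open>{x n..}\<close>, so the uniform estimate may be evaluated there.\<close>
  moreover have "filterlim (\<lambda>n. (n, ?w * y n)) (indexed_points (\<lambda>n. {x n..})) \<Phi>"
    unfolding filterlim_iff eventually_indexed_points
  proof (intro allI impI)
    fix P assume "\<forall>\<^sub>F n in sequentially. \<forall>y\<in>{x n..}. P (n, y)"
    then have "\<forall>\<^sub>F n in \<Phi>. \<forall>y\<in>{x n..}. P (n, y)"
      using n by (rule eventually_compose_filterlim)
    then show "\<forall>\<^sub>F n in \<Phi>. P (n, ?w * y n)"
      using inA y0
    proof eventually_elim
      case (elim n)
      have "x n \<le> y n"
        using y elim by blast
      also have "\<dots> \<le> ?w * y n"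
        using elim B by (simp add: algebra_simps)
      finally show ?case using elim by auto
    qed
  qed
  ultimately have 2: "((\<lambda>n. tailFn M \<xi> n (?w * y n) / (real n * F (?w * y n))) \<longlongrightarrow> 1) \<Phi>"
    using filterlim_compose by fastforce
  have "((\<lambda>n. tailFn M \<xi> n (?w * y n) / (real n * F (?w * y n)) * (F (?w * y n) / F (y n))) \<longlongrightarrow> 1 * (1 / ?w)) \<Phi>"
    using B by (intro tendsto_mult 2 filterlim_compose[OF F_ratio y_top]) (auto intro: add_pos_pos)
  moreover have "\<forall>\<^sub>F n in \<Phi>. tailFn M \<xi> n (?w * y n) / (real n * F (?w * y n)) * (F (?w * y n) / F (y n))
      = tailFn M \<xi> n (real n * G (y n) + 1 * y n) / (real n * F (1 * y n))"
    using y_eq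
  proof eventually_elim
    case (elim n)
    have "?w * y n = real n * G (y n) + 1 * y n"
      using B by (subst (1 2) elim[symmetric]) (simp add: field_simps)
    moreover have "F (?w * y n) \<noteq> 0"
      using F_pos[of "?w * y n"] by linarith
    ultimately show ?case by simp
  qed
  ultimately have "((\<lambda>n. tailFn M \<xi> n (real n * G (y n) + 1 * y n) / (real n * F (1 * y n)))
      \<longlongrightarrow> 1 * (1 / ?w)) \<Phi>"
    by (rule Lim_transform_eventually)
  \<comment> \<open>The same ratio has the limits 1 and \<open>1 / ?w\<close>, which differ because
    \<open>1 / B > 0\<close>.\<close>
  from tendsto_unique[OF \<open>\<Phi> \<noteq> bot\<close> 1 this] show False
    using B by (simp add: field_simps)
qed

text \<open>Any positive \<open>c\<close> below the liminf gives the scale condition at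
  \<open>x n\<close>, and \<open>G_ratio_mono\<close> spreads it over the interval.\<close>

lemma intermediate_tail:
  assumes x: "\<forall>n\<ge>1. 0 < x n \<and> x n \<le> x' n"
    and low: "0 < liminf (\<lambda>n. ereal (x n / (real n * G (x n))))"
    and a: "a \<longlonglongrightarrow> L" "0 < L"
  shows "(\<lambda>n. SUP y\<in>{x n..x' n}. ereal \<bar>tailFn M \<xi> n (real n * G y + a n * y)
      / (real n * F (a n * y)) - 1\<bar>) \<longlonglongrightarrow> 0"
proof -
  let ?\<Phi> = "indexed_points (\<lambda>n. {x n..x' n})"
  obtain c where c: "0 < c" "ereal c < liminf (\<lambda>n. ereal (x n / (real n * G (x n))))"
    using ereal_dense2[OF low] by auto
  have y0: "\<forall>\<^sub>F p in ?\<Phi>. 0 < snd p"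
    unfolding eventually_indexed_points using eventually_ge_at_top[of 1]
    by eventually_elim (use x in force)
  have scale: "\<forall>\<^sub>F p in ?\<Phi>. c * real (fst p) * G (snd p) \<le> snd p"
    unfolding eventually_indexed_points using less_LiminfD[OF c(2)] eventually_ge_at_top[of 1]
  proof eventually_elim
    case (elim n)
    then have "0 < x n" "0 < real n" "0 < G (x n)"
      using x G_pos by auto
    with elim(1) have "c * real n * G (x n) \<le> x n"
      by (simp add: field_simps)
    with \<open>0 < x n\<close> show ?case
      by (auto intro: G_ratio_mono)
  qed
  have "((\<lambda>p. tailFn M \<xi> (fst p) (real (fst p) * G (snd p) + a (fst p) * snd p)
      / (real (fst p) * F (a (fst p) * snd p))) \<longlongrightarrow> 1) ?\<Phi>"
    by (rule tailFn_shifted_asymp[OF filterlim_fst_indexed_points y0 c(1) scale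
          filterlim_compose[OF a(1) filterlim_fst_indexed_points] a(2)])
  moreover have "\<forall>\<^sub>F n in sequentially. {x n..x' n} \<noteq> {}"
    using eventually_ge_at_top[of 1] by eventually_elim (use x in auto)
  ultimately show ?thesis
    by (subst SUP_abs_tendsto_0_iff) auto
qed

text \<open>In terms of \<open>?r n\<close> the error in \<open>tailFn_near_1\<close> is
  \<open>?r n / (1 - ?r n)\<^sup>2\<close>, seen by extracting \<open>(n G (x n))\<^sup>2\<close>
  from its denominator. Positivity of \<open>?r\<close> turns limsup 0 into convergence to
  0.\<close>

lemma small_tail:
  assumes x: "\<forall>n\<ge>1. 0 < x n"
    and lim: "limsup (\<lambda>n. ereal (x n / (real n * G (x n)))) = 0"
  shows "(\<lambda>n. tailFn M \<xi> n (x n)) \<longlonglongrightarrow> 1"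
proof -
  let ?r = "\<lambda>n. x n / (real n * G (x n))"
  have pos: "0 < x n" "0 < real n" "0 < G (x n)" "0 < ?r n" if "1 \<le> n" for n
    using that x G_pos by auto
  have small: "\<forall>\<^sub>F n in sequentially. ?r n < e" if "0 < e" for e
    using Limsup_lessD[of sequentially "\<lambda>n. ereal (?r n)" "ereal e"] lim that by simp
  have r: "?r \<longlonglongrightarrow> 0"
  proof (rule tendstoI)
    fix e :: real assume "0 < e"
    show "\<forall>\<^sub>F n in sequentially. dist (?r n) 0 < e"
      using small[OF \<open>0 < e\<close>] eventually_ge_at_top[of 1]
    proof eventually_elim
      case (elim n)
      then show ?case
        using pos(4)[of n] by (simp only: dist_real_def diff_0_right abs_of_pos)
    qed
  qed
  have "(\<lambda>n. 1 - ?r n / (1 - ?r n)\<^sup>2) \<longlonglongrightarrow> 1 - 0 / (1 - 0)\<^sup>2"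
    by (intro tendsto_intros r) auto
  then have low: "(\<lambda>n. 1 - ?r n / (1 - ?r n)\<^sup>2) \<longlonglongrightarrow> 1"
    by simp
  show ?thesis
  proof (rule tendsto_sandwich[OF _ _ low tendsto_const])
    show "\<forall>\<^sub>F n in sequentially. 1 - ?r n / (1 - ?r n)\<^sup>2 \<le> tailFn M \<xi> n (x n)"
      using small[of 1, OF zero_less_one] eventually_ge_at_top[of 1]
    proof eventually_elim
      case (elim n)
      note p = pos[OF elim(2)]
      let ?g = "real n * G (x n)"
      have "0 < ?g" using p by simp
      have "?r n / (1 - ?r n)\<^sup>2 = (?g\<^sup>2 * ?r n) / (?g * (1 - ?r n))\<^sup>2"
        using \<open>0 < ?g\<close> by (simp add: power_mult_distrib)
      also have "?g\<^sup>2 * ?r n = real n * x n * G (x n)"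
        using p by (simp add: power2_eq_square)
      also have "?g * (1 - ?r n) = ?g - x n"
        using p by (simp add: right_diff_distrib)
      finally show ?case
        using tailFn_near_1[of n "x n"] p elim by simp
    qed
    show "\<forall>\<^sub>F n in sequentially. tailFn M \<xi> n (x n) \<le> 1"
      by (simp add: tailFn_def)
  qed
qed

end

theorem theorem1:
  fixes M :: "'a measure" and \<xi> :: "nat \<Rightarrow> 'a \<Rightarrow> real"
  assumes "prob_space M"
    and rv: "\<And>i. \<xi> i \<in> borel_measurable M"
    and indep: "prob_space.indep_vars M (\<lambda>_. borel) \<xi> UNIV"
    and ident: "\<And>i. distr M borel (\<xi> i) = distr M borel (\<xi> 0)"
    and nonneg: "\<And>i. AE \<omega> in M. \<xi> i \<omega> \<ge> 0"
    and tail: "slowly_varying (\<lambda>x. x * tailF M \<xi> x)"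
  shows
   "(\<forall>x :: nat \<Rightarrow> real. (\<forall>n\<ge>1. x n > 0) \<longrightarrow>
      (((\<lambda>n. SUP y\<in>{x n..}. ereal \<bar>tailFn M \<xi> n y / (real n * tailF M \<xi> y) - 1\<bar>)
          \<longlonglongrightarrow> 0)
       \<longleftrightarrow> filterlim (\<lambda>n. x n / (real n * Gint M \<xi> (x n))) at_top sequentially))
    \<and>
    (\<forall>(x :: nat \<Rightarrow> real) (x' :: nat \<Rightarrow> real) (a :: nat \<Rightarrow> real).
      (\<forall>n\<ge>1. x n > 0 \<and> x' n > 0 \<and> a n > 0 \<and> x n \<le> x' n) \<longrightarrow>
      liminf (\<lambda>n. ereal (x n / (real n * Gint M \<xi> (x n)))) > 0 \<longrightarrow>
      limsup (\<lambda>n. ereal (x' n / (real n * Gint M \<xi> (x' n)))) < \<infinity> \<longrightarrow>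
      (\<exists>L>0. a \<longlonglongrightarrow> L) \<longrightarrow>
      ((\<lambda>n. SUP y\<in>{x n..x' n}. ereal \<bar>tailFn M \<xi> n (real n * Gint M \<xi> y + a n * y)
            / (real n * tailF M \<xi> (a n * y)) - 1\<bar>) \<longlonglongrightarrow> 0))
    \<and>
    (\<forall>x :: nat \<Rightarrow> real. (\<forall>n\<ge>1. x n > 0) \<longrightarrow>
      limsup (\<lambda>n. ereal (x n / (real n * Gint M \<xi> (x n)))) = 0 \<longrightarrow>
      (\<lambda>n. tailFn M \<xi> n (x n)) \<longlonglongrightarrow> 1)"
proof -
  interpret prob_space M by fact
  \<comment> \<open>The positive parts agree almost surely with the given variables, so
    \<open>tailF\<close>, \<open>tailFn\<close> and \<open>Gint\<close> are unchanged, and they are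
    nonnegative everywhere as the locale demands.\<close>
  define \<eta> where "\<eta> = (\<lambda>i \<omega>. max 0 (\<xi> i \<omega>))"
  note rv[measurable]
  have [measurable]: "\<eta> i \<in> borel_measurable M" for i
    unfolding \<eta>_def by measurable
  have eq: "AE \<omega> in M. \<forall>i. \<eta> i \<omega> = \<xi> i \<omega>"
    unfolding AE_all_countable using nonneg by (auto simp: \<eta>_def max_def elim!: eventually_mono)
  have F: "tailF M \<eta> = tailF M \<xi>"
    unfolding tailF_def using eq
    by (intro ext finite_measure_eq_AE) (auto elim!: eventually_mono)
  have Fn: "tailFn M \<eta> = tailFn M \<xi>"
    unfolding tailFn_def using eq
    by (intro ext finite_measure_eq_AE) (auto elim!: eventually_mono)
  have G: "Gint M \<eta> = Gint M \<xi>"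
    unfolding Gint_def F ..
  have "distr M borel (\<eta> i) = distr (distr M borel (\<xi> i)) borel (max 0)" for i
    by (subst distr_distr) (auto simp: \<eta>_def comp_def)
  then have ident': "distr M borel (\<eta> i) = distr M borel (\<eta> 0)" for i
    using ident[of i] by simp
  interpret slowly_varying_iid M \<eta>
  proof
    show "indep_vars (\<lambda>_. borel) \<eta> UNIV"
      unfolding \<eta>_def by (rule indep_vars_compose2[OF indep]) auto
    show "distr M borel (\<eta> i) = distr M borel (\<eta> 0)" for i
      by (rule ident')
    show "slowly_varying (\<lambda>x. x * tailF M \<eta> x)"
      using tail by (simp only: F)
    show "random_variable borel (\<eta> i)" for i
      by measurable
    show "0 \<le> \<eta> i \<omega>" for i \<omega>
      by (simp add: \<eta>_def)
  qed
  show ?thesis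
    using uniform_tail_if[unfolded F Fn G] uniform_tail_only_if[unfolded F Fn G]
      intermediate_tail[unfolded F Fn G] small_tail[unfolded F Fn G]
    by (intro conjI allI impI iffI) blast+
qed

end
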